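(* Let $r\ge0$, let $f:A\to B$ be a morphism of finitely generated $E_r$-cofibrant dga's over a field $\mathbf{k}$ of characteristic $0$, and let $\mathbf{k}\subset\mathbf{K}$ be a field extension. Then $f$ admits an $r$-splitting if and only if $f_\mathbf{K}:=f\otimes_\mathbf{k}\mathbf{K}:A\otimes_\mathbf{k}\mathbf{K}\to B\otimes_\mathbf{k}\mathbf{K}$ admits an $r$-splitting.
   Context: Filtered dga's: a filtered dga over $\mathbf{k}$ is a non-negatively graded commutative dga $A$ over $\mathbf{k}$ (differential of degree $+1$) with an increasing multiplicative regular (for each $n$ some $W_qA^n=0$) exhaustive filtration $W$ by subcomplexes, with filtered unit ($\mathbf{k}$ trivially filtered); morphisms preserve filtrations. $E_r$-cofibrant dga's: given a filtered dga $A$, an $E_r$-cofibrant extension of degree $n$ and weight $p$ is $A\otimes_\xi\Lambda V$ where $V$ is a vector space concentrated in degree $n$ and pure weight $p$ ($W_{p-1}V=0$, $W_pV=V$) and $\xi:V\to W_{p-r}A^{n+1}$ is linear with $d\circ\xi=0$; differential $dv=\xi(v)$ and filtration extended multiplicatively. An $E_r$-cofibrant dga is the colimit of a sequence of $E_r$-cofibrant extensions starting from $\mathbf{k}$; it is finitely generated if it is obtained by finitely many such extensions with finite-dimensional $V$. $r$-splitting: an $r$-splitting of a filtered dga $A$ is a direct sum decomposition $A=\bigoplus_{p,q}A^{p,q}$ into subspaces such that $d(A^{p,q})\subset A^{p+r,q-r+1}$, $A^{p,q}\cdot A^{p',q'}\subset A^{p+p',q+q'}$ and $W_mA^n=\bigoplus_{p\le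 m}A^{-p,n+p}$. A morphism $f:A\to B$ admits an $r$-splitting if $A$ and $B$ admit $r$-splittings and $f(A^{p,q})\subset B^{p,q}$ for all $p,q$. *)

theory Defs
  imports Main
begin

definition subfield :: "'k::field set \<Rightarrow> bool" where
  "subfield F \<longleftrightarrow> 0 \<in> F \<and> 1 \<in> F \<and> (\<forall>a\<in>F. \<forall>b\<in>F. a + b \<in> F \<and> a * b \<in> F)
     \<and> (\<forall>a\<in>F. - a \<in> F \<and> inverse a \<in> F)"

definition fspan :: "'k set \<Rightarrow> ('k \<Rightarrow> 'a::ab_group_add \<Rightarrow> 'a) \<Rightarrow> 'a set \<Rightarrow> 'a set" where
  "fspan F sm S = {y. \<exists>T c. finite T \<and> T \<subseteq> S \<and> (\<forall>s\<in>T. c s \<in> F) \<and> y = (\<Sum>s\<in>T. sm (c s) s)}"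

definition is_subspace :: "'k set \<Rightarrow> ('k \<Rightarrow> 'a::ab_group_add \<Rightarrow> 'a) \<Rightarrow> 'a set \<Rightarrow> bool" where
  "is_subspace F sm V \<longleftrightarrow> 0 \<in> V \<and> (\<forall>x\<in>V. \<forall>y\<in>V. x + y \<in> V) \<and> (\<forall>c\<in>F. \<forall>x\<in>V. sm c x \<in> V)"

definition lin_indep :: "'k::zero set \<Rightarrow> ('k \<Rightarrow> 'a::ab_group_add \<Rightarrow> 'a) \<Rightarrow> 'a set \<Rightarrow> bool" where
  "lin_indep F sm T \<longleftrightarrow>
     (\<forall>c. (\<forall>s\<in>T. c s \<in> F) \<and> (\<Sum>s\<in>T. sm (c s) s) = 0 \<longrightarrow> (\<forall>s\<in>T. c s = 0))"

definition internal_dsum :: "('i \<Rightarrow> 'a::ab_group_add set) \<Rightarrow> 'a set \<Rightarrow> bool" where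
  "internal_dsum S X \<longleftrightarrow> (\<forall>i. S i \<subseteq> X) \<and>
     (\<forall>x\<in>X. \<exists>!h. (\<forall>i. h i \<in> S i) \<and> finite {i. h i \<noteq> 0} \<and> x = (\<Sum>i\<in>{i. h i \<noteq> 0}. h i))"

text \<open>Underlying additive group is the type 'a; scalars live in a field 'k, and the
  algebra is an F-vector space for a subfield F of 'k (so a dga over k and its base
  change to K can share the same scalar type).
  dg_deg n = A^n, dg_W q n = W_q A^n.\<close>

record ('k, 'a) fdga =
  dg_car :: "'a set"
  dg_smul :: "'k \<Rightarrow> 'a \<Rightarrow> 'a"
  dg_mul :: "'a \<Rightarrow> 'a \<Rightarrow> 'a"
  dg_one :: "'a"
  dg_d :: "'a \<Rightarrow> 'a"
  dg_deg :: "int \<Rightarrow> 'a set"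
  dg_W :: "int \<Rightarrow> int \<Rightarrow> 'a set"

definition fdga :: "'k::field set \<Rightarrow> ('k, 'a::ab_group_add) fdga \<Rightarrow> bool" where
  "fdga F A \<longleftrightarrow>
    (let V = dg_car A; sm = dg_smul A; m = dg_mul A; u = dg_one A; d = dg_d A;
         G = dg_deg A; W = dg_W A in
    subfield F \<and> is_subspace F sm V \<and>
    (\<forall>c\<in>F. \<forall>c'\<in>F. \<forall>x\<in>V. \<forall>y\<in>V.
        sm c (x + y) = sm c x + sm c y \<and> sm (c + c') x = sm c x + sm c' x \<and>
        sm c (sm c' x) = sm (c * c') x \<and> sm 1 x = x) \<and>
    \<comment> \<open>non-negative grading\<close>
    (\<forall>n. is_subspace F sm (G n)) \<and> (\<forall>n<0. G n = {0}) \<and> internal_dsum G V \<and>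
    \<comment> \<open>graded commutative algebra\<close>
    (\<forall>x\<in>V. \<forall>y\<in>V. m x y \<in> V) \<and>
    (\<forall>x\<in>V. \<forall>y\<in>V. \<forall>z\<in>V. m (x + y) z = m x z + m y z \<and> m x (y + z) = m x y + m x z
        \<and> m (m x y) z = m x (m y z)) \<and>
    (\<forall>c\<in>F. \<forall>x\<in>V. \<forall>y\<in>V. m (sm c x) y = sm c (m x y) \<and> m x (sm c y) = sm c (m x y)) \<and>
    u \<in> G 0 \<and> (\<forall>x\<in>V. m u x = x \<and> m x u = x) \<and>
    (\<forall>p q x y. x \<in> G p \<longrightarrow> y \<in> G q \<longrightarrow> m x y \<in> G (p + q)) \<and>
    (\<forall>p q x y. x \<in> G p \<longrightarrow> y \<in> G q \<longrightarrow>
        m x y = (if even (p * q) then m y x else - m y x)) \<and>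
    \<comment> \<open>differential of degree +1\<close>
    (\<forall>x\<in>V. \<forall>y\<in>V. d x \<in> V \<and> d (x + y) = d x + d y) \<and>
    (\<forall>c\<in>F. \<forall>x\<in>V. d (sm c x) = sm c (d x)) \<and>
    (\<forall>n x. x \<in> G n \<longrightarrow> d x \<in> G (n + 1)) \<and> (\<forall>x\<in>V. d (d x) = 0) \<and>
    (\<forall>p x y. x \<in> G p \<longrightarrow> y \<in> V \<longrightarrow>
        d (m x y) = m (d x) y + (if even p then m x (d y) else - m x (d y))) \<and>
    \<comment> \<open>increasing, multiplicative, regular, exhaustive filtration by subcomplexes, filtered unit\<close>
    (\<forall>q n. is_subspace F sm (W q n) \<and> W q n \<subseteq> G n \<and> W q n \<subseteq> W (q + 1) n) \<and>
    (\<forall>n. \<forall>x\<in>G n. \<exists>q. x \<in> W q n) \<and>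
    (\<forall>n. \<exists>q. W q n = {0}) \<and>
    (\<forall>q q' a b x y. x \<in> W q a \<longrightarrow> y \<in> W q' b \<longrightarrow> m x y \<in> W (q + q') (a + b)) \<and>
    (\<forall>q n x. x \<in> W q n \<longrightarrow> d x \<in> W q (n + 1)) \<and>
    u \<in> W 0 0)"

definition fdga_mor :: "'k::field set \<Rightarrow> ('k, 'a::ab_group_add) fdga \<Rightarrow> ('k, 'b::ab_group_add) fdga
    \<Rightarrow> ('a \<Rightarrow> 'b) \<Rightarrow> bool" where
  "fdga_mor F A B f \<longleftrightarrow> fdga F A \<and> fdga F B \<and>
    (\<forall>x\<in>dg_car A. f x \<in> dg_car B \<and> f (dg_d A x) = dg_d B (f x)) \<and>
    (\<forall>x\<in>dg_car A. \<forall>y\<in>dg_car A. f (x + y) = f x + f y \<and>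
        f (dg_mul A x y) = dg_mul B (f x) (f y)) \<and>
    (\<forall>c\<in>F. \<forall>x\<in>dg_car A. f (dg_smul A c x) = dg_smul B c (f x)) \<and>
    f (dg_one A) = dg_one B \<and>
    (\<forall>n. f ` dg_deg A n \<subseteq> dg_deg B n) \<and>
    (\<forall>q n. f ` dg_W A q n \<subseteq> dg_W B q n)"

definition mpow :: "('k, 'a) fdga \<Rightarrow> 'a \<Rightarrow> nat \<Rightarrow> 'a" where
  "mpow A x k = ((dg_mul A x) ^^ k) (dg_one A)"

definition mono :: "('k, 'a) fdga \<Rightarrow> 'a list \<Rightarrow> (nat \<Rightarrow> nat) \<Rightarrow> 'a" where
  "mono A xs e = foldr (\<lambda>i acc. dg_mul A (mpow A (xs ! i) (e i)) acc) [0..<length xs] (dg_one A)"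

definition adm :: "int list \<Rightarrow> (nat \<Rightarrow> nat) set" where
  "adm dgs = {e. (\<forall>i\<ge>length dgs. e i = 0) \<and> (\<forall>i<length dgs. odd (dgs ! i) \<longrightarrow> e i \<le> 1)}"

definition mwt :: "int list \<Rightarrow> (nat \<Rightarrow> nat) \<Rightarrow> int" where
  "mwt wts e = (\<Sum>i<length wts. int (e i) * wts ! i)"

text \<open>A is (isomorphic to) a finite sequence of E_r-cofibrant extensions starting from
  the ground field, each adding one generator x_i of degree dgs!i and pure weight wts!i
  with d x_i in W_{wts!i - r} of the subalgebra generated by x_0..x_(i-1).  (An extension
  by a finite-dimensional V is the same as successive extensions by a basis of V.)
  Freeness: the ordered monomials form an F-basis; the filtration is the multiplicative
  one, i.e. W_q is spanned by monomials of total weight at most q.\<close>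
definition fg_Er_cofibrant :: "'k::field set \<Rightarrow> nat \<Rightarrow> ('k, 'a::ab_group_add) fdga \<Rightarrow> bool" where
  "fg_Er_cofibrant F r A \<longleftrightarrow> fdga F A \<and>
    (\<exists>xs dgs wts. length dgs = length xs \<and> length wts = length xs \<and>
      (\<forall>i<length xs. xs ! i \<in> dg_deg A (dgs ! i)) \<and>
      (\<forall>E c. finite E \<and> E \<subseteq> adm dgs \<and> (\<forall>e\<in>E. c e \<in> F) \<and>
          (\<Sum>e\<in>E. dg_smul A (c e) (mono A xs e)) = 0 \<longrightarrow> (\<forall>e\<in>E. c e = 0)) \<and>
      dg_car A = fspan F (dg_smul A) (mono A xs ` adm dgs) \<and>
      (\<forall>i<length xs. dg_d A (xs ! i) \<in> fspan F (dg_smul A)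
          (mono A xs ` {e \<in> adm dgs. (\<forall>j\<ge>i. e j = 0) \<and> mwt wts e \<le> wts ! i - int r})) \<and>
      (\<forall>q n. dg_W A q n = dg_deg A n \<inter> fspan F (dg_smul A) (mono A xs ` {e \<in> adm dgs. mwt wts e \<le> q})))"

definition r_splitting :: "'k::field set \<Rightarrow> nat \<Rightarrow> ('k, 'a::ab_group_add) fdga \<Rightarrow> (int \<Rightarrow> int \<Rightarrow> 'a set) \<Rightarrow> bool" where
  "r_splitting F r A S \<longleftrightarrow>
    (\<forall>p q. is_subspace F (dg_smul A) (S p q)) \<and>
    internal_dsum (\<lambda>(p, q). S p q) (dg_car A) \<and>
    (\<forall>p q x. x \<in> S p q \<longrightarrow> dg_d A x \<in> S (p + int r) (q - int r + 1)) \<and>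
    (\<forall>p q p' q' x y. x \<in> S p q \<longrightarrow> y \<in> S p' q' \<longrightarrow> dg_mul A x y \<in> S (p + p') (q + q')) \<and>
    (\<forall>m n. dg_W A m n = {\<Sum>p\<in>P. y p | P y. finite P \<and> P \<subseteq> {..m} \<and> (\<forall>p\<in>P. y p \<in> S (- p) (n + p))})"

definition mor_has_splitting :: "'k::field set \<Rightarrow> nat \<Rightarrow> ('k, 'a::ab_group_add) fdga \<Rightarrow> ('k, 'b::ab_group_add) fdga
    \<Rightarrow> ('a \<Rightarrow> 'b) \<Rightarrow> bool" where
  "mor_has_splitting F r A B f \<longleftrightarrow>
    (\<exists>SA SB. r_splitting F r A SA \<and> r_splitting F r B SB \<and> (\<forall>p q. f ` SA p q \<subseteq> SB p q))"

text \<open>AK is A tensored with K (= UNIV of the scalar type) over the subfield k: A sits inside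
  AK as a k-form, i.e. with the same operations, AK and each A^n, W_q A^n K-span the
  corresponding pieces of AK, and k-linearly independent finite subsets of A stay
  K-linearly independent (so A \<otimes>_k K \<rightarrow> AK is an isomorphism of filtered graded spaces).\<close>
definition base_change :: "'k::field set \<Rightarrow> ('k, 'a::ab_group_add) fdga \<Rightarrow> ('k, 'a) fdga \<Rightarrow> bool" where
  "base_change k A AK \<longleftrightarrow>
    dg_smul A = dg_smul AK \<and> dg_mul A = dg_mul AK \<and> dg_one A = dg_one AK \<and> dg_d A = dg_d AK \<and>
    dg_car A \<subseteq> dg_car AK \<and>
    (\<forall>n. dg_deg A n = dg_deg AK n \<inter> dg_car A) \<and>
    (\<forall>q n. dg_W A q n = dg_W AK q n \<inter> dg_car A) \<and>
    dg_car AK = fspan UNIV (dg_smul AK) (dg_car A) \<and>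
    (\<forall>n. dg_deg AK n = fspan UNIV (dg_smul AK) (dg_deg A n)) \<and>
    (\<forall>q n. dg_W AK q n = fspan UNIV (dg_smul AK) (dg_W A q n)) \<and>
    (\<forall>T. finite T \<and> T \<subseteq> dg_car A \<and> lin_indep k (dg_smul A) T \<longrightarrow> lin_indep UNIV (dg_smul A) T)"

end

theory Submission
  imports Defs
begin

text \<open>An r-splitting is the same as a derivation \<open>\<theta>\<close> of degree 0 acting as \<open>p\<close> on
  \<open>Gr\<^sup>W\<^sub>p\<close> and satisfying \<open>d \<theta> = \<theta> d + r d\<close>: let \<open>\<theta>\<close> act as the scalar \<open>-p\<close> on the
  summand \<open>A\<^sup>p\<^sup>,\<^sup>q\<close>; conversely, by regularity of \<open>W\<close> and characteristic 0 such a \<open>\<theta>\<close> is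
  diagonalizable and its eigenspaces form a splitting. Compatibility with \<open>f\<close> becomes
  \<open>f \<theta>\<^sub>A = \<theta>\<^sub>B f\<close>. All these conditions are affine linear in \<open>\<theta>\<close>, with coefficients in the
  small field. Hence \<open>\<theta>\<close> extends from A to its base change, and a solution over the big field
  descends by restricting it to A and composing with \<open>id \<otimes> \<pi>\<close>, where \<open>\<pi>\<close> is a linear
  retraction of the big field onto the small one.\<close>


section \<open>Additive maps on subsets of an abelian group\<close>

text \<open>The shift by r comes from a sign: \<open>dg_W A m n\<close> collects the summands
  \<open>S (- p) (n + p)\<close> with p at most m, so the first index is minus the weight, and a
  differential that raises it by r lowers the weight by r. For fixed x and y in A the Leibniz rule
  is linear in \<theta>, so the projection that descends a solution has to respect only products
  with one factor in A; it is in general not multiplicative on the base change. Normalising \<pi> by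
  \<open>\<pi> 1 = 1\<close> preserves the inhomogeneous terms of the equations, namely r times d
  and q times the identity. The argument is uniform in the extension, algebraic or transcendental.
  The base change is not a constructed tensor product but an algebra that contains A as a k-form. A
  map on it is prescribed on multiples of elements of A, and such a prescription is well defined
  because linear independence over k persists over the big field.\<close>

definition additive_on :: "'a::ab_group_add set \<Rightarrow> ('a \<Rightarrow> 'b::ab_group_add) \<Rightarrow> bool" where
  "additive_on X g \<longleftrightarrow> 0 \<in> X \<and> (\<forall>x\<in>X. \<forall>y\<in>X. x + y \<in> X \<and> g (x + y) = g x + g y)"

text \<open>Scalars and negatives are left out on purpose: the generating sets that occur are unions
  of subspaces or sets of all multiples, so plain sums reach everything and an additive map is
  controlled without any linearity.\<close>

inductive_set add_span :: "'a::ab_group_add set \<Rightarrow> 'a set" for U where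
  zero: "0 \<in> add_span U"
| step: "u \<in> U \<Longrightarrow> y \<in> add_span U \<Longrightarrow> u + y \<in> add_span U"

lemma additive_on_zero:
  assumes "additive_on X g" shows "g 0 = 0"
proof -
  have "g (0 + 0) = g 0 + g 0" using assms unfolding additive_on_def by blast
  then show ?thesis by simp
qed

lemma additive_on_diff:
  assumes "additive_on X g" "y \<in> X" "x - y \<in> X" shows "g (x - y) = g x - g y"
proof -
  have "g ((x - y) + y) = g (x - y) + g y" using assms unfolding additive_on_def by blast
  then show ?thesis by simp
qed

text \<open>The map h is arbitrary; its additivity is a way to supply that Y contains 0 and is
  closed under addition.\<close>

lemma additive_on_subset:
  "additive_on X g \<Longrightarrow> Y \<subseteq> X \<Longrightarrow> additive_on Y h \<Longrightarrow> additive_on Y g"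
  unfolding additive_on_def by blast

lemma additive_on_compose:
  assumes "additive_on X g" "additive_on Y h" "\<And>x. x \<in> X \<Longrightarrow> g x \<in> Y"
  shows "additive_on X (\<lambda>x. h (g x))"
  using assms by (simp add: additive_on_def)

lemma additive_on_plus:
  "additive_on X g \<Longrightarrow> additive_on X h \<Longrightarrow> additive_on X (\<lambda>x. g x + h x)"
  by (simp add: additive_on_def algebra_simps)

lemma additive_on_minus:
  "additive_on X g \<Longrightarrow> additive_on X h \<Longrightarrow> additive_on X (\<lambda>x. g x - h x)"
  by (simp add: additive_on_def algebra_simps)

lemma additive_on_sum:
  assumes "additive_on X g" "finite I" "\<And>i. i \<in> I \<Longrightarrow> h i \<in> X"
  shows "sum h I \<in> X \<and> g (sum h I) = (\<Sum>i\<in>I. g (h i))"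
  using assms(2,3)
proof (induction I rule: finite_induct)
  case empty
  then show ?case using assms(1) additive_on_zero[OF assms(1)] by (auto simp: additive_on_def)
next
  case (insert i I)
  then show ?case using assms(1) by (auto simp: additive_on_def)
qed

lemma sum_in_add_span:
  assumes "finite I" "\<And>i. i \<in> I \<Longrightarrow> h i \<in> U"
  shows "sum h I \<in> add_span U"
  using assms by (induction I rule: finite_induct) (auto intro: add_span.intros)

text \<open>Main device for identities between maps: they are tested on homogeneous vectors of a
  splitting or on multiples of elements of A. Bilinear identities take two applications, one per
  argument.\<close>

lemma additive_on_eqI:
  assumes "additive_on X g" "additive_on X h" "X \<subseteq> add_span U" "U \<subseteq> X"
    and "\<And>u. u \<in> U \<Longrightarrow> g u = h u" and "x \<in> X"
  shows "g x = h x"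
proof -
  have "x \<in> add_span U" using assms by blast
  then have "x \<in> X \<and> g x = h x"
  proof induction
    case zero
    then show ?case using additive_on_zero assms(1,2) by (metis additive_on_def)
  next
    case (step u y)
    then have "u \<in> X" "g u = h u" using assms by auto
    then show ?case using step assms(1,2) unfolding additive_on_def by simp
  qed
  then show ?thesis ..
qed

lemma additive_on_memI:
  assumes "additive_on X g" "X \<subseteq> add_span U" "U \<subseteq> X"
    and "\<And>u. u \<in> U \<Longrightarrow> g u \<in> Y" and "0 \<in> Y" "\<And>x y. x \<in> Y \<Longrightarrow> y \<in> Y \<Longrightarrow> x + y \<in> Y"
    and "x \<in> X"
  shows "g x \<in> Y"
proof -
  have "x \<in> add_span U" using assms by blast
  then have "x \<in> X \<and> g x \<in> Y"
  proof induction
    case zero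
    then show ?case using additive_on_zero[OF assms(1)] assms(1,5) by (simp add: additive_on_def)
  next
    case (step u y)
    then have "u \<in> X" "g u \<in> Y" using assms by auto
    then show ?case using step assms(1,6) unfolding additive_on_def by simp
  qed
  then show ?thesis ..
qed

lemma add_span_add:
  "x \<in> add_span U \<Longrightarrow> y \<in> add_span U \<Longrightarrow> x + y \<in> add_span U"
  by (induction rule: add_span.induct) (auto simp: add.assoc intro: add_span.intros)

lemma add_span_sum:
  "(\<And>i. i \<in> I \<Longrightarrow> h i \<in> add_span U) \<Longrightarrow> sum h I \<in> add_span U"
  by (induction I rule: infinite_finite_induct) (auto intro: add_span_add add_span.zero)

text \<open>Addends with the same index are merged into one, which is why each \<open>S i\<close>
  has to be closed under addition.\<close>

lemma add_span_UN_E: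
  assumes "x \<in> add_span (\<Union>i. S i)"
    and add: "\<And>i x y. x \<in> S i \<Longrightarrow> y \<in> S i \<Longrightarrow> x + y \<in> S i"
  shows "\<exists>I h. finite I \<and> (\<forall>i\<in>I. h i \<in> S i) \<and> x = sum h I"
  using assms(1)
proof induction
  case zero
  then show ?case by (intro exI[of _ "{}"]) simp
next
  case (step u y)
  then obtain j I h where j: "u \<in> S j" and I: "finite I" "\<forall>i\<in>I. h i \<in> S i" "y = sum h I" by blast
  define h' where "h' = h(j := if j \<in> I then u + h j else u)"
  have "u + y = sum h' (insert j I)"
  proof (cases "j \<in> I")
    case True
    then show ?thesis using I sum.remove[of I j h] sum.remove[of I j h']
      by (simp add: h'_def insert_absorb add.assoc)
  next
    case False
    then show ?thesis using I by (auto simp: h'_def intro!: sum.cong)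
  qed
  moreover have "\<forall>i\<in>insert j I. h' i \<in> S i" using j I add by (auto simp: h'_def)
  ultimately show ?case using I(1) by blast
qed

lemma fspan_subset_add_span: "fspan F sm S \<subseteq> add_span {sm c s | c s. c \<in> F \<and> s \<in> S}"
  by (auto simp: fspan_def intro!: sum_in_add_span)

text \<open>X is presented as the quotient of the direct sum of the groups \<open>G i\<close>, and
  \<open>compat\<close> says that every relation among the generators is also satisfied by their
  prescribed images. It serves twice: for a direct sum, where \<open>u i\<close> is an inclusion,
  and for a tensor product, where i is a vector and \<open>G i\<close> a copy of the
  scalars.\<close>

lemma extend_additive:
  fixes u :: "'i \<Rightarrow> 'g::ab_group_add \<Rightarrow> 'a::ab_group_add"
    and v :: "'i \<Rightarrow> 'g \<Rightarrow> 'x::ab_group_add"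
  assumes zero: "\<And>i. i \<in> J \<Longrightarrow> 0 \<in> G i"
    and add: "\<And>i x y. i \<in> J \<Longrightarrow> x \<in> G i \<Longrightarrow> y \<in> G i \<Longrightarrow> x + y \<in> G i"
    and uminus: "\<And>i x. i \<in> J \<Longrightarrow> x \<in> G i \<Longrightarrow> - x \<in> G i"
    and u: "\<And>i x y. i \<in> J \<Longrightarrow> x \<in> G i \<Longrightarrow> y \<in> G i \<Longrightarrow> u i (x + y) = u i x + u i y"
    and v: "\<And>i x y. i \<in> J \<Longrightarrow> x \<in> G i \<Longrightarrow> y \<in> G i \<Longrightarrow> v i (x + y) = v i x + v i y"
    and compat: "\<And>I h. finite I \<Longrightarrow> I \<subseteq> J \<Longrightarrow> (\<And>i. i \<in> I \<Longrightarrow> h i \<in> G i) \<Longrightarrow>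
        (\<Sum>i\<in>I. u i (h i)) = 0 \<Longrightarrow> (\<Sum>i\<in>I. v i (h i)) = 0"
    and X: "X = {\<Sum>i\<in>I. u i (h i) | I h. finite I \<and> I \<subseteq> J \<and> (\<forall>i\<in>I. h i \<in> G i)}"
  obtains E where "additive_on X E" "\<And>i x. i \<in> J \<Longrightarrow> x \<in> G i \<Longrightarrow> E (u i x) = v i x"
proof -
  define R where "R x y \<longleftrightarrow> (\<exists>I h. finite I \<and> I \<subseteq> J \<and> (\<forall>i\<in>I. h i \<in> G i)
      \<and> x = (\<Sum>i\<in>I. u i (h i)) \<and> y = (\<Sum>i\<in>I. v i (h i)))" for x y
  have u0: "u i 0 = 0" if "i \<in> J" for i using u[OF that zero zero] that by simp
  have v0: "v i 0 = 0" if "i \<in> J" for i using v[OF that zero zero] that by simp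
  have um: "u i (- x) = - u i x" if "i \<in> J" "x \<in> G i" for i x
    using u[of i x "- x"] u0 that uminus by (simp add: eq_neg_iff_add_eq_0 add.commute)
  have vm: "v i (- x) = - v i x" if "i \<in> J" "x \<in> G i" for i x
    using v[of i x "- x"] v0 that uminus by (simp add: eq_neg_iff_add_eq_0 add.commute)
  have R_add: "R (x + x') (y + y')" if "R x y" "R x' y'" for x x' y y'
  proof -
    from \<open>R x y\<close> obtain I h where I: "finite I" "I \<subseteq> J" "\<forall>i\<in>I. h i \<in> G i"
      "x = (\<Sum>i\<in>I. u i (h i))" "y = (\<Sum>i\<in>I. v i (h i))" unfolding R_def by blast
    from \<open>R x' y'\<close> obtain I' h' where I': "finite I'" "I' \<subseteq> J" "\<forall>i\<in>I'. h' i \<in> G i"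
      "x' = (\<Sum>i\<in>I'. u i (h' i))" "y' = (\<Sum>i\<in>I'. v i (h' i))" unfolding R_def by blast
    \<comment> \<open>Both families are padded by 0 to a common index set, so that they can be added
      termwise.\<close>
    define a where "a i = (if i \<in> I then h i else 0)" for i
    define a' where "a' i = (if i \<in> I' then h' i else 0)" for i
    have aG: "a i \<in> G i" "a' i \<in> G i" if "i \<in> I \<union> I'" for i
      using that I I' zero by (auto simp: a_def a'_def)
    have J: "i \<in> J" if "i \<in> I \<union> I'" for i using that I I' by auto
    have "x = (\<Sum>i\<in>I \<union> I'. u i (a i))" "y = (\<Sum>i\<in>I \<union> I'. v i (a i))"
      unfolding I(4,5) using I I' u0 v0
      by (auto intro!: sum.mono_neutral_cong_left simp: a_def)
    moreover have "x' = (\<Sum>i\<in>I \<union> I'. u i (a' i))" "y' = (\<Sum>i\<in>I \<union> I'. v i (a' i))"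
      unfolding I'(4,5) using I I' u0 v0
      by (auto intro!: sum.mono_neutral_cong_left simp: a'_def)
    ultimately have "x + x' = (\<Sum>i\<in>I \<union> I'. u i (a i + a' i))"
      "y + y' = (\<Sum>i\<in>I \<union> I'. v i (a i + a' i))"
      by (simp_all only: sum.distrib[symmetric] u[OF J aG] v[OF J aG] cong: sum.cong)
    moreover have "\<forall>i\<in>I \<union> I'. a i + a' i \<in> G i" using aG J add by blast
    ultimately show ?thesis using I(1,2) I'(1,2) unfolding R_def
      by (intro exI[of _ "I \<union> I'"] exI[of _ "\<lambda>i. a i + a' i"]) auto
  qed
  have R_uminus: "R (- x) (- y)" if "R x y" for x y
  proof -
    from that obtain I h where I: "finite I" "I \<subseteq> J" "\<forall>i\<in>I. h i \<in> G i"
      "x = (\<Sum>i\<in>I. u i (h i))" "y = (\<Sum>i\<in>I. v i (h i))" unfolding R_def by blast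
    have "- x = (\<Sum>i\<in>I. u i (- h i))" "- y = (\<Sum>i\<in>I. v i (- h i))"
      using I um vm by (auto simp: sum_negf[symmetric] subset_iff intro!: sum.cong)
    then show ?thesis using I uminus unfolding R_def
      by (intro exI[of _ I] exI[of _ "\<lambda>i. - h i"]) auto
  qed
  \<comment> \<open>Two representations of the same x differ by a representation of 0, to which
    \<open>compat\<close> applies; closure under negation is needed for this difference.\<close>
  have R_unique: "y = y'" if "R x y" "R x y'" for x y y'
  proof -
    have "R (x + - x) (y + - y')" using that R_add R_uminus by blast
    then obtain I h where I: "finite I" "I \<subseteq> J" "\<forall>i\<in>I. h i \<in> G i"
      "0 = (\<Sum>i\<in>I. u i (h i))" "y - y' = (\<Sum>i\<in>I. v i (h i))" unfolding R_def by auto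
    then have "y - y' = 0" using compat[of I h] by simp
    then show ?thesis by simp
  qed
  define E where "E x = (THE y. R x y)" for x
  have E: "E x = y" if "R x y" for x y
    unfolding E_def using that R_unique by blast
  have X_R: "x \<in> X \<longleftrightarrow> (\<exists>y. R x y)" for x unfolding X R_def by blast
  show thesis
  proof
    have "R 0 0" unfolding R_def by (intro exI[of _ "{}"]) auto
    moreover have "\<exists>z. R (x + y) z" "E (x + y) = E x + E y" if "\<exists>z. R x z" "\<exists>z. R y z" for x y
    proof -
      obtain x' y' where xy: "R x x'" "R y y'" using \<open>\<exists>z. R x z\<close> \<open>\<exists>z. R y z\<close> by blast
      then show "\<exists>z. R (x + y) z" "E (x + y) = E x + E y"
        using R_add[OF xy] E by auto
    qed
    ultimately show "additive_on X E"
      by (auto simp: additive_on_def X_R)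
  next
    fix i x assume "i \<in> J" "x \<in> G i"
    then have "R (u i x) (v i x)" unfolding R_def
      by (intro exI[of _ "{i}"] exI[of _ "\<lambda>_. x"]) auto
    then show "E (u i x) = v i x" by (rule E)
  qed
qed

section \<open>Internal direct sums\<close>

lemma internal_dsum_generates:
  assumes "internal_dsum S X" shows "X \<subseteq> add_span (\<Union>i. S i)"
proof
  fix x assume "x \<in> X"
  then obtain h where "\<forall>i. h i \<in> S i" "finite {i. h i \<noteq> 0}" "x = (\<Sum>i\<in>{i. h i \<noteq> 0}. h i)"
    using assms unfolding internal_dsum_def by blast
  then show "x \<in> add_span (\<Union>i. S i)" by (auto intro!: sum_in_add_span)
qed

text \<open>A vanishing sum, extended by 0 outside I, is a decomposition of 0, and uniqueness
  identifies it with the zero family.\<close>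

lemma internal_dsum_independent:
  assumes S: "internal_dsum S X" and zero: "\<And>i. 0 \<in> S i"
    and I: "finite I" "\<And>i. i \<in> I \<Longrightarrow> h i \<in> S i" "sum h I = 0" "i \<in> I"
  shows "h i = 0"
proof -
  define h' where "h' i = (if i \<in> I then h i else 0)" for i
  define D where "D h \<longleftrightarrow> (\<forall>i. h i \<in> S i) \<and> finite {i. h i \<noteq> 0} \<and> 0 = (\<Sum>i\<in>{i. h i \<noteq> 0}. h i)" for h
  have "0 \<in> X" using assms unfolding internal_dsum_def by blast
  then have "\<exists>!h. D h"
    using S unfolding internal_dsum_def D_def by blast
  moreover have sub: "{i. h' i \<noteq> 0} \<subseteq> I" by (auto simp: h'_def)
  have "sum h I = (\<Sum>i\<in>{i. h' i \<noteq> 0}. h' i)"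
    using I(1) by (intro sum.mono_neutral_cong_right) (auto simp: h'_def)
  then have "D h'"
    unfolding D_def using I zero finite_subset[OF sub] by (auto simp: h'_def)
  moreover have "D (\<lambda>_. 0)"
    unfolding D_def using zero by simp
  ultimately have "h' = (\<lambda>_. 0)" by blast
  then have "h' i = 0" by simp
  then show ?thesis using I(4) by (simp add: h'_def)
qed

text \<open>\<open>diff\<close> does double duty: together with \<open>zero\<close> it gives closure
  under addition, which collects the terms of one index, and it turns two decompositions of x into a
  relation to which \<open>ind\<close> applies.\<close>

lemma internal_dsumI:
  assumes sub: "\<And>i. S i \<subseteq> X" and zero: "\<And>i. 0 \<in> S i"
    and diff: "\<And>i x y. x \<in> S i \<Longrightarrow> y \<in> S i \<Longrightarrow> x - y \<in> S i"
    and gen: "X \<subseteq> add_span (\<Union>i. S i)"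
    and ind: "\<And>I h i. finite I \<Longrightarrow> (\<And>i. i \<in> I \<Longrightarrow> h i \<in> S i) \<Longrightarrow> sum h I = 0 \<Longrightarrow> i \<in> I \<Longrightarrow> h i = 0"
  shows "internal_dsum S X"
  unfolding internal_dsum_def
proof (intro conjI ballI allI)
  show "S i \<subseteq> X" for i by (rule sub)
  fix x assume "x \<in> X"
  let ?D = "\<lambda>h. (\<forall>i. h i \<in> S i) \<and> finite {i. h i \<noteq> 0} \<and> x = (\<Sum>i\<in>{i. h i \<noteq> 0}. h i)"
  show "\<exists>!h. ?D h"
  proof (rule ex_ex1I)
    have "x + y \<in> S i" if "x \<in> S i" "y \<in> S i" for x y i
      using diff[OF that(1) diff[OF zero that(2)]] by simp
    then obtain I h where I: "finite I" "\<forall>i\<in>I. h i \<in> S i" "x = sum h I"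
      using add_span_UN_E[of x S] gen \<open>x \<in> X\<close> by (metis subsetD)
    define h' where "h' i = (if i \<in> I then h i else 0)" for i
    have "{i. h' i \<noteq> 0} \<subseteq> I" by (auto simp: h'_def)
    then have "finite {i. h' i \<noteq> 0}" using I(1) finite_subset by blast
    moreover have "x = (\<Sum>i\<in>{i. h' i \<noteq> 0}. h' i)"
      unfolding I(3) using I(1) by (intro sum.mono_neutral_cong_right) (auto simp: h'_def)
    ultimately have "?D h'" using I(2) zero by (auto simp: h'_def)
    then show "\<exists>h. ?D h" by (rule exI[of ?D])
  next
    fix h h' assume h: "?D h" and h': "?D h'"
    let ?I = "{i. h i \<noteq> 0} \<union> {i. h' i \<noteq> 0}"
    have "sum h {i. h i \<noteq> 0} = sum h ?I" "sum h' {i. h' i \<noteq> 0} = sum h' ?I"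
      using h h' by (intro sum.mono_neutral_left; auto)+
    then have "(\<Sum>i\<in>?I. h i - h' i) = 0" unfolding sum_subtractf using h h' by simp
    then have "h i - h' i = 0" if "i \<in> ?I" for i
      using ind[of ?I "\<lambda>i. h i - h' i" i] h h' diff that by blast
    then have "h i = h' i" for i by (cases "i \<in> ?I") auto
    then show "h = h'" ..
  qed
qed

section \<open>Filtered dga's\<close>

locale filtered_dga =
  fixes F :: "'k::field set" and A :: "('k, 'a::ab_group_add) fdga"
  assumes fdga: "fdga F A"
begin

lemma
  shows subfield_F: "subfield F"
    and car_subspace: "is_subspace F (dg_smul A) (dg_car A)"
    and vector_axioms: "\<forall>c\<in>F. \<forall>c'\<in>F. \<forall>x\<in>dg_car A. \<forall>y\<in>dg_car A.
        dg_smul A c (x + y) = dg_smul A c x + dg_smul A c y \<and>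
        dg_smul A (c + c') x = dg_smul A c x + dg_smul A c' x \<and>
        dg_smul A c (dg_smul A c' x) = dg_smul A (c * c') x \<and> dg_smul A 1 x = x"
    and deg_axiom: "\<forall>n. is_subspace F (dg_smul A) (dg_deg A n)"
    and deg_dsum: "internal_dsum (dg_deg A) (dg_car A)"
    and mul_car_axiom: "\<forall>x\<in>dg_car A. \<forall>y\<in>dg_car A. dg_mul A x y \<in> dg_car A"
    and mul_add_axiom: "\<forall>x\<in>dg_car A. \<forall>y\<in>dg_car A. \<forall>z\<in>dg_car A.
        dg_mul A (x + y) z = dg_mul A x z + dg_mul A y z \<and>
        dg_mul A x (y + z) = dg_mul A x y + dg_mul A x z \<and>
        dg_mul A (dg_mul A x y) z = dg_mul A x (dg_mul A y z)"
    and mul_smul_axiom: "\<forall>c\<in>F. \<forall>x\<in>dg_car A. \<forall>y\<in>dg_car A.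
        dg_mul A (dg_smul A c x) y = dg_smul A c (dg_mul A x y) \<and>
        dg_mul A x (dg_smul A c y) = dg_smul A c (dg_mul A x y)"
    and mul_deg_axiom: "\<forall>p q x y. x \<in> dg_deg A p \<longrightarrow> y \<in> dg_deg A q \<longrightarrow> dg_mul A x y \<in> dg_deg A (p + q)"
    and d_axiom: "\<forall>x\<in>dg_car A. \<forall>y\<in>dg_car A.
        dg_d A x \<in> dg_car A \<and> dg_d A (x + y) = dg_d A x + dg_d A y"
    and d_smul_axiom: "\<forall>c\<in>F. \<forall>x\<in>dg_car A. dg_d A (dg_smul A c x) = dg_smul A c (dg_d A x)"
    and d_deg_axiom: "\<forall>n x. x \<in> dg_deg A n \<longrightarrow> dg_d A x \<in> dg_deg A (n + 1)"
    and W_axiom: "\<forall>q n. is_subspace F (dg_smul A) (dg_W A q n) \<and> dg_W A q n \<subseteq> dg_deg A n \<and>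
        dg_W A q n \<subseteq> dg_W A (q + 1) n"
    and W_exhaustive_axiom: "\<forall>n. \<forall>x\<in>dg_deg A n. \<exists>q. x \<in> dg_W A q n"
    and W_regular_axiom: "\<forall>n. \<exists>q. dg_W A q n = {0}"
  using fdga[unfolded fdga_def Let_def] by - (elim conjE, assumption)+

lemma deg_subspace: "is_subspace F (dg_smul A) (dg_deg A n)"
  using deg_axiom by blast

lemma mul_car [simp]: "x \<in> dg_car A \<Longrightarrow> y \<in> dg_car A \<Longrightarrow> dg_mul A x y \<in> dg_car A"
  using mul_car_axiom by blast

lemma mul_add:
  assumes "x \<in> dg_car A" "y \<in> dg_car A" "z \<in> dg_car A"
  shows "dg_mul A (x + y) z = dg_mul A x z + dg_mul A y z"
    "dg_mul A x (y + z) = dg_mul A x y + dg_mul A x z"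
  using mul_add_axiom assms by simp_all

lemma mul_smul:
  assumes "c \<in> F" "x \<in> dg_car A" "y \<in> dg_car A"
  shows "dg_mul A (dg_smul A c x) y = dg_smul A c (dg_mul A x y)"
    "dg_mul A x (dg_smul A c y) = dg_smul A c (dg_mul A x y)"
  using mul_smul_axiom assms by simp_all

lemma mul_deg: "x \<in> dg_deg A p \<Longrightarrow> y \<in> dg_deg A q \<Longrightarrow> dg_mul A x y \<in> dg_deg A (p + q)"
  using mul_deg_axiom by blast

lemma d_car [simp]: "x \<in> dg_car A \<Longrightarrow> dg_d A x \<in> dg_car A"
  using d_axiom by blast

lemma d_add: "x \<in> dg_car A \<Longrightarrow> y \<in> dg_car A \<Longrightarrow> dg_d A (x + y) = dg_d A x + dg_d A y"
  using d_axiom by blast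

lemma d_smul: "c \<in> F \<Longrightarrow> x \<in> dg_car A \<Longrightarrow> dg_d A (dg_smul A c x) = dg_smul A c (dg_d A x)"
  using d_smul_axiom by blast

lemma d_deg: "x \<in> dg_deg A n \<Longrightarrow> dg_d A x \<in> dg_deg A (n + 1)"
  using d_deg_axiom by blast

lemma W_subspace: "is_subspace F (dg_smul A) (dg_W A q n)"
  and W_deg: "dg_W A q n \<subseteq> dg_deg A n"
  and W_Suc: "dg_W A q n \<subseteq> dg_W A (q + 1) n"
  using W_axiom by blast+

lemma W_exhaustive: "x \<in> dg_deg A n \<Longrightarrow> \<exists>q. x \<in> dg_W A q n"
  using W_exhaustive_axiom by blast

lemma W_regular: "\<exists>q. dg_W A q n = {0}"
  using W_regular_axiom by blast

lemma W_mono: "q \<le> q' \<Longrightarrow> dg_W A q n \<subseteq> dg_W A q' n"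
  by (induction q' rule: int_ge_induct) (use W_Suc in blast)+

lemma deg_car: "dg_deg A n \<subseteq> dg_car A"
  using deg_dsum unfolding internal_dsum_def by blast

lemma W_car: "dg_W A q n \<subseteq> dg_car A"
  using W_deg deg_car by blast

lemma scalars [simp]:
  "0 \<in> F" "1 \<in> F" "a \<in> F \<Longrightarrow> b \<in> F \<Longrightarrow> a + b \<in> F" "a \<in> F \<Longrightarrow> b \<in> F \<Longrightarrow> a * b \<in> F"
  "a \<in> F \<Longrightarrow> - a \<in> F" "a \<in> F \<Longrightarrow> inverse a \<in> F"
  using subfield_F unfolding subfield_def by auto

lemma scalar_diff [simp]: "a \<in> F \<Longrightarrow> b \<in> F \<Longrightarrow> a - b \<in> F"
  using scalars(3)[of a "- b"] by simp

lemma of_nat_scalar [simp]: "of_nat n \<in> F"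
  by (induction n) auto

text \<open>Weights are integers, so the eigenvalues of a weight derivation lie in every subfield;
  this lets the same eigenvalue equations make sense over both fields.\<close>

lemma of_int_scalar [simp]: "of_int i \<in> F"
  by (cases i rule: int_cases2) auto

lemma car_closed [simp]:
  "0 \<in> dg_car A" "x \<in> dg_car A \<Longrightarrow> y \<in> dg_car A \<Longrightarrow> x + y \<in> dg_car A"
  "c \<in> F \<Longrightarrow> x \<in> dg_car A \<Longrightarrow> dg_smul A c x \<in> dg_car A"
  using car_subspace unfolding is_subspace_def by auto

lemma smul_add:
  "c \<in> F \<Longrightarrow> x \<in> dg_car A \<Longrightarrow> y \<in> dg_car A \<Longrightarrow>
    dg_smul A c (x + y) = dg_smul A c x + dg_smul A c y"
  using vector_axioms by blast

lemma add_smul: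
  "c \<in> F \<Longrightarrow> c' \<in> F \<Longrightarrow> x \<in> dg_car A \<Longrightarrow>
    dg_smul A (c + c') x = dg_smul A c x + dg_smul A c' x"
  using vector_axioms by blast

lemma smul_smul:
  "c \<in> F \<Longrightarrow> c' \<in> F \<Longrightarrow> x \<in> dg_car A \<Longrightarrow>
    dg_smul A c (dg_smul A c' x) = dg_smul A (c * c') x"
  using vector_axioms by blast

lemma smul_one [simp]: "x \<in> dg_car A \<Longrightarrow> dg_smul A 1 x = x"
  using vector_axioms scalars by blast

lemma smul_zero_left [simp]: "x \<in> dg_car A \<Longrightarrow> dg_smul A 0 x = 0"
  using add_smul[of 0 0 x] by simp

lemma additive_smul: "c \<in> F \<Longrightarrow> additive_on (dg_car A) (dg_smul A c)"
  unfolding additive_on_def using smul_add by simp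

lemma smul_zero_right [simp]: "c \<in> F \<Longrightarrow> dg_smul A c 0 = 0"
  using additive_on_zero additive_smul by blast

lemma smul_minus_left: "c \<in> F \<Longrightarrow> x \<in> dg_car A \<Longrightarrow> dg_smul A (- c) x = - dg_smul A c x"
  using add_smul[of c "- c" x] by (simp add: eq_neg_iff_add_eq_0 add.commute)

lemma smul_minus_one: "x \<in> dg_car A \<Longrightarrow> dg_smul A (- 1) x = - x"
  using smul_minus_left[of 1] by simp

lemma subspace_uminus:
  "is_subspace F (dg_smul A) U \<Longrightarrow> U \<subseteq> dg_car A \<Longrightarrow> x \<in> U \<Longrightarrow> - x \<in> U"
  unfolding is_subspace_def using smul_minus_one[of x] scalars(5)[OF scalars(2)] by fastforce

lemma subspace_diff:
  "is_subspace F (dg_smul A) U \<Longrightarrow> U \<subseteq> dg_car A \<Longrightarrow> x \<in> U \<Longrightarrow> y \<in> U \<Longrightarrow> x - y \<in> U"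
  using subspace_uminus[of U y] unfolding is_subspace_def diff_conv_add_uminus by blast

lemma subspace_sum:
  "is_subspace F (dg_smul A) U \<Longrightarrow> (\<And>i. i \<in> I \<Longrightarrow> h i \<in> U) \<Longrightarrow> sum h I \<in> U"
  by (induction I rule: infinite_finite_induct) (auto simp: is_subspace_def)

lemma car_uminus [simp]: "x \<in> dg_car A \<Longrightarrow> - x \<in> dg_car A"
  using subspace_uminus[OF car_subspace] by blast

lemma car_diff [simp]: "x \<in> dg_car A \<Longrightarrow> y \<in> dg_car A \<Longrightarrow> x - y \<in> dg_car A"
  using subspace_diff[OF car_subspace] by blast

lemma smul_diff_left:
  "c \<in> F \<Longrightarrow> c' \<in> F \<Longrightarrow> x \<in> dg_car A \<Longrightarrow> dg_smul A (c - c') x = dg_smul A c x - dg_smul A c' x"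
  using add_smul[of c "- c'" x] smul_minus_left[of c' x] by simp

lemma smul_cancel:
  assumes "c \<in> F" "c \<noteq> 0" "x \<in> dg_car A"
  shows "dg_smul A (inverse c) (dg_smul A c x) = x" "dg_smul A c (dg_smul A (inverse c) x) = x"
  using assms by (simp_all add: smul_smul)

end

section \<open>Splittings and weight derivations\<close>

text \<open>Preservation of degree is contained in the last clause, since W is exhaustive and
  \<open>dg_W A q n\<close> lies in degree n. The Leibniz rule carries no sign because the degree is
  0.\<close>

definition weight_derivation ::
    "'k::field set \<Rightarrow> nat \<Rightarrow> ('k, 'a::ab_group_add) fdga \<Rightarrow> ('a \<Rightarrow> 'a) \<Rightarrow> bool" where
  "weight_derivation F r A \<theta> \<longleftrightarrow>
    (\<forall>x\<in>dg_car A. \<theta> x \<in> dg_car A) \<and> additive_on (dg_car A) \<theta> \<and>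
    (\<forall>c\<in>F. \<forall>x\<in>dg_car A. \<theta> (dg_smul A c x) = dg_smul A c (\<theta> x)) \<and>
    (\<forall>x\<in>dg_car A. \<forall>y\<in>dg_car A. \<theta> (dg_mul A x y) = dg_mul A (\<theta> x) y + dg_mul A x (\<theta> y)) \<and>
    (\<forall>x\<in>dg_car A. dg_d A (\<theta> x) = \<theta> (dg_d A x) + dg_smul A (of_nat r) (dg_d A x)) \<and>
    (\<forall>q n. \<forall>x\<in>dg_W A q n. \<theta> x - dg_smul A (of_int q) x \<in> dg_W A (q - 1) n)"

text \<open>The eigenvalue is \<open>- p\<close> because the first index of a splitting is minus the
  weight, while \<open>p + q\<close> is the total degree.\<close>

definition weight_space :: "('k::field, 'a::ab_group_add) fdga \<Rightarrow> ('a \<Rightarrow> 'a) \<Rightarrow> int \<Rightarrow> int \<Rightarrow> 'a set" where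
  "weight_space A \<theta> p q = {x \<in> dg_deg A (p + q). \<theta> x = dg_smul A (of_int (- p)) x}"

section \<open>From a splitting to its weight derivation\<close>

context filtered_dga
begin

lemma additive_d: "additive_on (dg_car A) (dg_d A)"
  by (simp add: additive_on_def d_add)

lemma additive_mul:
  assumes "y \<in> dg_car A"
  shows "additive_on (dg_car A) (\<lambda>x. dg_mul A x y)" "additive_on (dg_car A) (dg_mul A y)"
  using assms by (simp_all add: additive_on_def mul_add)

text \<open>Once \<theta> is defined summand by summand, each property reflects one clause of a
  splitting: eigenvalues add under products because bidegrees do, and d changes the eigenvalue by -r
  because it raises the first index by r.\<close>

lemma splitting_imp_weight_derivation:
  assumes S: "r_splitting F r A S"
  obtains \<theta> where "weight_derivation F r A \<theta>"
    "\<And>p q x. x \<in> S p q \<Longrightarrow> \<theta> x = dg_smul A (of_int (- p)) x"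
proof -
  let ?S = "\<lambda>(p, q). S p q" and ?V = "dg_car A"
  let ?v = "\<lambda>i. dg_smul A (of_int (- fst i))"
  from S have sub: "\<And>p q. is_subspace F (dg_smul A) (S p q)"
    and dsum: "internal_dsum ?S ?V"
    and Sd: "\<And>p q x. x \<in> S p q \<Longrightarrow> dg_d A x \<in> S (p + int r) (q - int r + 1)"
    and Smul: "\<And>p q p' q' x y. x \<in> S p q \<Longrightarrow> y \<in> S p' q' \<Longrightarrow> dg_mul A x y \<in> S (p + p') (q + q')"
    and SW: "\<And>m n. dg_W A m n = {\<Sum>p\<in>P. y p | P y. finite P \<and> P \<subseteq> {..m} \<and> (\<forall>p\<in>P. y p \<in> S (- p) (n + p))}"
    unfolding r_splitting_def by blast+
  have S_car: "?S i \<subseteq> ?V" for i using dsum unfolding internal_dsum_def by blast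
  have S_car': "x \<in> S p q \<Longrightarrow> x \<in> ?V" for p q x using S_car[of "(p, q)"] by auto
  have S_sub: "is_subspace F (dg_smul A) (?S i)" for i using sub by (cases i) simp
  have S_zero: "0 \<in> ?S i" for i using S_sub unfolding is_subspace_def by blast
  obtain \<theta> where add: "additive_on ?V \<theta>"
    and eig: "\<And>i x. x \<in> ?S i \<Longrightarrow> \<theta> x = ?v i x"
  proof (rule extend_additive[where J = UNIV and G = ?S and u = "\<lambda>_ x. x" and v = ?v and X = ?V])
    show "x + y \<in> ?S i" if "x \<in> ?S i" "y \<in> ?S i" for i x y
      using that S_sub[of i] unfolding is_subspace_def by blast
    show "- x \<in> ?S i" if "x \<in> ?S i" for i x
      using that S_sub S_car subspace_uminus by blast
    show "?v i (x + y) = ?v i x + ?v i y" if "x \<in> ?S i" "y \<in> ?S i" for i x y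
      using that S_car[of i] by (intro smul_add) auto
    show "(\<Sum>i\<in>I. ?v i (h i)) = 0"
      if "finite I" "\<And>i. i \<in> I \<Longrightarrow> h i \<in> ?S i" "(\<Sum>i\<in>I. h i) = 0" for I h
      using internal_dsum_independent[OF dsum S_zero that] by simp
    show "?V = {\<Sum>i\<in>I. h i | I h. finite I \<and> I \<subseteq> UNIV \<and> (\<forall>i\<in>I. h i \<in> ?S i)}"
    proof (intro equalityI subsetI)
      fix x assume "x \<in> ?V"
      then have "x \<in> add_span (\<Union>i. ?S i)" using internal_dsum_generates[OF dsum] by blast
      moreover have "x + y \<in> ?S i" if "x \<in> ?S i" "y \<in> ?S i" for i x y
        using that S_sub[of i] unfolding is_subspace_def by blast
      ultimately show "x \<in> {\<Sum>i\<in>I. h i | I h. finite I \<and> I \<subseteq> UNIV \<and> (\<forall>i\<in>I. h i \<in> ?S i)}"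
        using add_span_UN_E[of x ?S] by blast
    next
      fix x assume "x \<in> {\<Sum>i\<in>I. h i | I h. finite I \<and> I \<subseteq> UNIV \<and> (\<forall>i\<in>I. h i \<in> ?S i)}"
      then obtain I h where h: "\<forall>i\<in>I. h i \<in> ?S i" "x = sum h I" by blast
      show "x \<in> ?V" unfolding h(2)
        by (rule subspace_sum[OF car_subspace]) (use h(1) S_car in blast)
    qed
  qed (use S_zero in auto)
  note gen = internal_dsum_generates[OF dsum]
  have USV: "(\<Union>i. ?S i) \<subseteq> ?V" using S_car by blast
  have eig': "\<theta> x = dg_smul A (of_int (- p)) x" if "x \<in> S p q" for p q x
    using eig[of x "(p, q)"] that by simp
  have car: "\<theta> x \<in> ?V" if "x \<in> ?V" for x
    by (rule additive_on_memI[OF add gen USV _ _ _ that]) (use eig S_car in \<open>auto simp: subset_iff\<close>)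
  have "weight_derivation F r A \<theta>"
    unfolding weight_derivation_def
  proof (intro conjI ballI allI)
    fix c x assume c: "c \<in> F" and x: "x \<in> ?V"
    show "\<theta> (dg_smul A c x) = dg_smul A c (\<theta> x)"
    proof (rule additive_on_eqI[OF additive_on_compose[OF additive_smul[OF c] add]
          additive_on_compose[OF add additive_smul[OF c]] gen USV _ x])
      fix u assume "u \<in> (\<Union>i. ?S i)"
      then obtain p q where u: "u \<in> S p q" by auto
      then have "dg_smul A c u \<in> S p q" using sub c unfolding is_subspace_def by blast
      then show "\<theta> (dg_smul A c u) = dg_smul A c (\<theta> u)"
        using eig'[OF u] eig' c S_car'[OF u] by (simp add: smul_smul mult.commute)
    qed (use c car in auto)
  next
    have hom: "\<theta> (dg_mul A u v) = dg_mul A (\<theta> u) v + dg_mul A u (\<theta> v)"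
      if uv: "u \<in> (\<Union>i. ?S i)" "v \<in> (\<Union>i. ?S i)" for u v
    proof -
      obtain p q where u: "u \<in> S p q" using uv(1) by auto
      obtain p' q' where v: "v \<in> S p' q'" using uv(2) by auto
      have "u \<in> ?V" "v \<in> ?V" using u v S_car' by auto
      then show ?thesis
        using eig'[OF u] eig'[OF v] eig'[OF Smul[OF u v]]
        by (simp add: mul_smul add_smul[symmetric])
    qed
    fix x y assume x: "x \<in> ?V" and y: "y \<in> ?V"
    \<comment> \<open>The bilinear identity is reached one argument at a time: u homogeneous with y
      arbitrary first, then both arbitrary.\<close>
    have hom1: "\<theta> (dg_mul A u y) = dg_mul A (\<theta> u) y + dg_mul A u (\<theta> y)" if "u \<in> (\<Union>i. ?S i)" for u
    proof (rule additive_on_eqI[OF _ _ gen USV hom[OF that] y])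
      have u: "u \<in> ?V" using that USV by blast
      show "additive_on ?V (\<lambda>a. \<theta> (dg_mul A u a))"
        using u by (intro additive_on_compose[OF additive_mul(2) add]) auto
      show "additive_on ?V (\<lambda>a. dg_mul A (\<theta> u) a + dg_mul A u (\<theta> a))"
        using u car by (intro additive_on_plus additive_on_compose[OF add additive_mul(2)] additive_mul(2)) auto
    qed
    show "\<theta> (dg_mul A x y) = dg_mul A (\<theta> x) y + dg_mul A x (\<theta> y)"
    proof (rule additive_on_eqI[OF _ _ gen USV hom1 x])
      show "additive_on ?V (\<lambda>a. \<theta> (dg_mul A a y))"
        using y by (intro additive_on_compose[OF additive_mul(1) add]) auto
      show "additive_on ?V (\<lambda>a. dg_mul A (\<theta> a) y + dg_mul A a (\<theta> y))"
        using y car by (intro additive_on_plus additive_on_compose[OF add additive_mul(1)] additive_mul(1)) auto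
    qed
  next
    fix x assume x: "x \<in> ?V"
    show "dg_d A (\<theta> x) = \<theta> (dg_d A x) + dg_smul A (of_nat r) (dg_d A x)"
    proof (rule additive_on_eqI[OF _ _ gen USV _ x])
      show "additive_on ?V (\<lambda>x. dg_d A (\<theta> x))"
        by (rule additive_on_compose[OF add additive_d]) (rule car)
      show "additive_on ?V (\<lambda>x. \<theta> (dg_d A x) + dg_smul A (of_nat r) (dg_d A x))"
        by (intro additive_on_plus additive_on_compose[OF additive_d add]
            additive_on_compose[OF additive_d additive_smul]) auto
      fix u assume "u \<in> (\<Union>i. ?S i)"
      then obtain p q where u: "u \<in> S p q" by auto
      then show "dg_d A (\<theta> u) = \<theta> (dg_d A u) + dg_smul A (of_nat r) (dg_d A u)"
        using eig'[OF u] eig'[OF Sd[OF u]] S_car'[OF u]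
        by (simp add: d_smul add_smul[symmetric])
    qed
  next
    fix q n x assume x: "x \<in> dg_W A q n"
    then obtain P y where P: "finite P" "P \<subseteq> {..q}" "\<forall>p\<in>P. y p \<in> S (- p) (n + p)" "x = sum y P"
      unfolding SW by blast
    let ?D = "\<lambda>x. \<theta> x - dg_smul A (of_int q) x"
    have "?D x = (\<Sum>p\<in>P. ?D (y p))"
      unfolding P(4) using P(3) S_car'
      by (intro conjunct2[OF additive_on_sum[OF additive_on_minus[OF add additive_smul] P(1)]]) auto
    also have "\<dots> \<in> dg_W A (q - 1) n"
    proof (rule subspace_sum[OF W_subspace])
      fix p assume p: "p \<in> P"
      have yp: "y p \<in> dg_W A p n"
        unfolding SW using p P(3) by (intro CollectI exI[of _ "{p}"] exI[of _ y]) auto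
      \<comment> \<open>The component of weight p is scaled by p - q: it vanishes for p = q, and for
        p < q it already lies in \<open>dg_W A (q - 1) n\<close>.\<close>
      have "?D (y p) = dg_smul A (of_int (p - q)) (y p)"
        using eig'[of "y p" "- p" "n + p"] p P(3) subsetD[OF W_car yp] by (simp add: smul_diff_left)
      moreover have "dg_smul A (of_int (p - q)) (y p) \<in> dg_W A (q - 1) n"
      proof (cases "p = q")
        case True
        then show ?thesis using subsetD[OF W_car yp] W_subspace by (simp add: is_subspace_def)
      next
        case False
        then have "p \<le> q - 1" using p P(2) by auto
        then have "y p \<in> dg_W A (q - 1) n" using yp W_mono by blast
        then show ?thesis using W_subspace[of "q - 1" n] of_int_scalar unfolding is_subspace_def by blast
      qed
      ultimately show "?D (y p) \<in> dg_W A (q - 1) n" by simp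
    qed
    finally show "?D x \<in> dg_W A (q - 1) n" .
  qed (use car add in auto)
  then show thesis using that eig' by blast
qed

end

section \<open>Diagonalisation of a weight derivation in characteristic 0\<close>

locale filtered_dga_char0 = filtered_dga F A
  for F :: "'k::field_char_0 set" and A :: "('k, 'a::ab_group_add) fdga"
begin

lemma smul_of_int_eq_0:
  assumes "i \<noteq> 0" "x \<in> dg_car A" "dg_smul A (of_int i) x = 0" shows "x = 0"
  using smul_cancel(1)[of "of_int i" x] assms by simp

text \<open>Applying \<theta> minus \<open>w j\<close> removes the vector at j and scales each other
  one by \<open>w i - w j\<close>, a nonzero integer and hence an invertible scalar in
  characteristic 0. The family is indexed by I with \<open>w\<close> injective, rather than by
  eigenvalues, so that bidegrees can serve as indices.\<close>

lemma eigenvectors_independent: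
  assumes \<theta>: "weight_derivation F r A \<theta>" and "finite I"
    and "\<And>i. i \<in> I \<Longrightarrow> h i \<in> dg_car A"
    and "\<And>i. i \<in> I \<Longrightarrow> \<theta> (h i) = dg_smul A (of_int (w i)) (h i)"
    and "inj_on w I" "sum h I = 0" "i \<in> I"
  shows "h i = 0"
  using assms(2-)
proof (induction I arbitrary: h i rule: finite_induct)
  case empty
  then show ?case by simp
next
  case (insert j I)
  have add: "additive_on (dg_car A) \<theta>" using \<theta> unfolding weight_derivation_def by blast
  have lin: "\<theta> (dg_smul A c x) = dg_smul A c (\<theta> x)" if "c \<in> F" "x \<in> dg_car A" for c x
    using \<theta> that unfolding weight_derivation_def by blast
  let ?D = "\<lambda>x. \<theta> x - dg_smul A (of_int (w j)) x"
  have Dadd: "additive_on (dg_car A) ?D"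
    by (intro additive_on_minus add additive_smul) simp
  define h' where "h' i = dg_smul A (of_int (w i - w j)) (h i)" for i
  have D: "?D (h i) = h' i" if "i \<in> insert j I" for i
    using insert.prems(1,2)[OF that] by (simp add: h'_def smul_diff_left)
  have "sum h' (insert j I) = (\<Sum>i\<in>insert j I. ?D (h i))" using D by simp
  also have "\<dots> = ?D (sum h (insert j I))"
    using additive_on_sum[OF Dadd, of "insert j I" h] insert by auto
  also have "\<dots> = 0" using insert.prems(4) additive_on_zero[OF Dadd] by simp
  finally have "sum h' I = 0"
    using insert.hyps insert.prems(1)[of j] by (simp add: h'_def)
  moreover have "\<theta> (h' i) = dg_smul A (of_int (w i)) (h' i)" if "i \<in> I" for i
    using insert.prems(1,2)[of i] that by (simp add: h'_def lin smul_smul mult.commute)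
  ultimately have "h' i = 0" if "i \<in> I" for i
    using insert.IH[of h' i] insert.prems(1,3) that by (auto simp: h'_def)
  moreover have "w i - w j \<noteq> 0" if "i \<in> I" for i
    using insert.prems(3) insert.hyps that by (auto simp: inj_on_def)
  ultimately have zero: "h i = 0" if "i \<in> I" for i
    using smul_of_int_eq_0[of "w i - w j" "h i"] insert.prems(1)[of i] that by (auto simp: h'_def)
  then have "h j = 0" using insert.prems(4) insert.hyps by simp
  then show ?case using zero insert.prems(5) by auto
qed

text \<open>If an eigenvector of eigenvalue p lies in weight at most q + 1 with q + 1 > p, then p -
  (q + 1) times it lies in weight at most q, and this integer can be divided out. Descending from
  any bound given by exhaustiveness stops exactly at p.\<close>

lemma eigenvector_in_W:
  assumes \<theta>: "weight_derivation F r A \<theta>"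
    and x: "x \<in> dg_deg A n" "\<theta> x = dg_smul A (of_int p) x"
  shows "x \<in> dg_W A p n"
proof -
  obtain q where q: "x \<in> dg_W A q n" using W_exhaustive x by blast
  show ?thesis
  proof (cases "p \<le> q")
    case False
    then show ?thesis using q W_mono[of q p n] by auto
  next
    case True
    then show ?thesis using q
    proof (induction q rule: int_ge_induct)
      case (step q)
      have car: "x \<in> dg_car A" using x deg_car by blast
      have "\<theta> x - dg_smul A (of_int (q + 1)) x \<in> dg_W A (q + 1 - 1) n"
        using \<theta> step.prems unfolding weight_derivation_def by blast
      then have "dg_smul A (of_int (p - (q + 1))) x \<in> dg_W A q n"
        using x(2) smul_diff_left[of "of_int p" "of_int (q + 1)" x] car
        by (simp only: of_int_diff of_int_scalar) simp
      then have "dg_smul A (inverse (of_int (p - (q + 1)))) (dg_smul A (of_int (p - (q + 1))) x) \<in> dg_W A q n"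
        using W_subspace[of q n] unfolding is_subspace_def by (meson of_int_scalar scalars(6))
      moreover have "(of_int (p - (q + 1)) :: 'k) \<noteq> 0" using step.hyps by (subst of_int_eq_0_iff) simp
      ultimately have "x \<in> dg_W A q n" using smul_cancel(1)[OF _ _ car] by (metis of_int_scalar)
      then show ?case by (rule step.IH)
    qed
  qed
qed

text \<open>Induction on the weight, starting where regularity makes W vanish. In the step, \<theta>
  minus m + 1 moves x into weight at most m, where a decomposition is known; inverting this operator
  on the eigenvectors found there corrects x to an eigenvector of eigenvalue m + 1.\<close>

lemma W_eigen_decomposition:
  assumes \<theta>: "weight_derivation F r A \<theta>" and x: "x \<in> dg_W A m n"
  shows "\<exists>P y. finite P \<and> P \<subseteq> {..m} \<and> (\<forall>p\<in>P. y p \<in> weight_space A \<theta> (- p) (n + p)) \<and> x = sum y P"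
proof -
  have add: "additive_on (dg_car A) \<theta>" using \<theta> unfolding weight_derivation_def by blast
  have lin: "\<theta> (dg_smul A c x) = dg_smul A c (\<theta> x)" if "c \<in> F" "x \<in> dg_car A" for c x
    using \<theta> that unfolding weight_derivation_def by blast
  obtain q where q: "dg_W A q n = {0}" using W_regular by blast
  have zero: ?thesis if "x = 0" using that by (intro exI[of _ "{}"]) simp
  show ?thesis
  proof (cases "q \<le> m")
    case False
    then have "x = 0" using W_mono[of m q n] q x by auto
    then show ?thesis by (rule zero)
  next
    case True
    then show ?thesis using x
    proof (induction m arbitrary: x rule: int_ge_induct)
      case base
      then show ?case using q by (intro exI[of _ "{}"]) simp
    next
      case (step m)
      let ?D = "\<lambda>x. \<theta> x - dg_smul A (of_int (m + 1)) x"
      have Dadd: "additive_on (dg_car A) ?D"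
        by (intro additive_on_minus add additive_smul of_int_scalar)
      have "?D x \<in> dg_W A (m + 1 - 1) n"
        using \<theta> step.prems unfolding weight_derivation_def by blast
      then obtain P y where P: "finite P" "P \<subseteq> {..m}"
        "\<forall>p\<in>P. y p \<in> weight_space A \<theta> (- p) (n + p)" "?D x = sum y P"
        using step.IH[of "?D x"] by auto
      have y: "y p \<in> dg_deg A n" "y p \<in> dg_car A" "\<theta> (y p) = dg_smul A (of_int p) (y p)"
        if "p \<in> P" for p
        using P(3) that deg_car by (auto simp: weight_space_def)
      define c where "c p = (of_int (p - (m + 1)) :: 'k)" for p
      have c: "c p \<in> F" "inverse (c p) \<in> F" for p by (simp_all add: c_def del: of_int_diff of_int_add)
      have c0: "c p \<noteq> 0" if "p \<in> P" for p
        unfolding c_def using that P(2) by (subst of_int_eq_0_iff) auto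
      \<comment> \<open>On the p-eigenspace \<open>?D\<close> is multiplication by
        \<open>c p\<close>, which is nonzero because p is at most m. Thus \<open>sum z P\<close> has
        the same image as x under \<open>?D\<close>, and their difference is killed by it.\<close>
      define z where "z p = dg_smul A (inverse (c p)) (y p)" for p
      have z: "z p \<in> dg_deg A n" "z p \<in> dg_car A" "\<theta> (z p) = dg_smul A (of_int p) (z p)"
        if "p \<in> P" for p
        using y[OF that] c deg_subspace[of n]
        by (auto simp: z_def lin smul_smul mult.commute is_subspace_def)
      have Dz: "?D (z p) = y p" if "p \<in> P" for p
      proof -
        have "?D (z p) = dg_smul A (c p) (z p)"
          using z[OF that] by (simp add: c_def smul_diff_left del: of_int_add)
        then show ?thesis using smul_cancel(2)[OF c(1) c0 y(2)] that by (simp add: z_def)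
      qed
      define x' where "x' = x - sum z P"
      have x: "x \<in> dg_deg A n" "x \<in> dg_car A" using step.prems W_deg W_car by blast+
      have Z: "sum z P \<in> dg_deg A n" "sum z P \<in> dg_car A"
        using z by (auto intro!: subspace_sum[OF deg_subspace] subspace_sum[OF car_subspace])
      have x': "x' \<in> dg_deg A n" "x' \<in> dg_car A"
        unfolding x'_def using x Z subspace_diff[OF deg_subspace deg_car] by auto
      have "?D x' = ?D x - ?D (sum z P)"
        unfolding x'_def by (rule additive_on_diff[OF Dadd]) (use x Z in auto)
      also have "?D (sum z P) = (\<Sum>p\<in>P. ?D (z p))"
        using additive_on_sum[OF Dadd P(1), of z] z by blast
      also have "\<dots> = ?D x" unfolding P(4) using Dz by (auto intro!: sum.cong)
      finally have "\<theta> x' = dg_smul A (of_int (m + 1)) x'" by simp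
      then have "x' \<in> weight_space A \<theta> (- (m + 1)) (n + (m + 1))"
        using x' by (simp add: weight_space_def add.commute)
      moreover have "z p \<in> weight_space A \<theta> (- p) (n + p)" if "p \<in> P" for p
        using z[OF that] by (simp add: weight_space_def)
      moreover have "m + 1 \<notin> P" using P(2) by auto
      then have "x = (\<Sum>p\<in>insert (m + 1) P. if p = m + 1 then x' else z p)"
        using P(1) by (auto simp: x'_def intro!: sum.cong)
      ultimately show ?case using P(1,2)
        by (intro exI[of _ "insert (m + 1) P"] exI[of _ "\<lambda>p. if p = m + 1 then x' else z p"]) auto
    qed
  qed
qed

text \<open>The decomposition exists because each homogeneous component lies in some W and so splits
  into eigenvectors. In the description of W, one inclusion is that decomposition and the other says
  that an eigenvector lies in the weight of its eigenvalue.\<close>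

lemma weight_derivation_imp_splitting:
  assumes \<theta>: "weight_derivation F r A \<theta>"
  shows "r_splitting F r A (weight_space A \<theta>)"
proof -
  let ?S = "weight_space A \<theta>" and ?V = "dg_car A"
  have add: "additive_on ?V \<theta>" using \<theta> unfolding weight_derivation_def by blast
  have lin: "\<theta> (dg_smul A c x) = dg_smul A c (\<theta> x)" if "c \<in> F" "x \<in> ?V" for c x
    using \<theta> that unfolding weight_derivation_def by blast
  have S_car: "x \<in> ?V" if "x \<in> ?S p q" for x p q using that deg_car by (auto simp: weight_space_def)
  have sub: "is_subspace F (dg_smul A) (?S p q)" for p q
    unfolding is_subspace_def
  proof (intro conjI ballI)
    show "0 \<in> ?S p q"
      using deg_subspace additive_on_zero[OF add] by (simp add: weight_space_def is_subspace_def)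
  next
    fix x y assume xy: "x \<in> ?S p q" "y \<in> ?S p q"
    then have "\<theta> (x + y) = \<theta> x + \<theta> y" using add S_car unfolding additive_on_def by blast
    then show "x + y \<in> ?S p q" using xy S_car[OF xy(1)] S_car[OF xy(2)] deg_subspace
      by (auto simp: weight_space_def is_subspace_def smul_add)
  next
    fix c x assume c: "c \<in> F" and x: "x \<in> ?S p q"
    then show "dg_smul A c x \<in> ?S p q" using S_car[OF x] deg_subspace
      by (auto simp: weight_space_def is_subspace_def lin smul_smul mult.commute)
  qed
  have dsum: "internal_dsum (\<lambda>(p, q). ?S p q) ?V"
  proof (rule internal_dsumI)
    show "(case i of (p, q) \<Rightarrow> ?S p q) \<subseteq> ?V" for i using S_car by (cases i) auto
    show "0 \<in> (case i of (p, q) \<Rightarrow> ?S p q)" for i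
      using sub by (cases i) (auto simp: is_subspace_def)
    show "x - y \<in> (case i of (p, q) \<Rightarrow> ?S p q)"
      if "x \<in> (case i of (p, q) \<Rightarrow> ?S p q)" "y \<in> (case i of (p, q) \<Rightarrow> ?S p q)" for i x y
      using that S_car subspace_diff[OF sub] by (cases i) (auto simp: subset_iff)
    show "?V \<subseteq> add_span (\<Union>i. case i of (p, q) \<Rightarrow> ?S p q)"
    proof
      fix x assume "x \<in> ?V"
      then obtain h where h: "\<forall>n. h n \<in> dg_deg A n" "x = (\<Sum>n\<in>{n. h n \<noteq> 0}. h n)"
        using deg_dsum unfolding internal_dsum_def by blast
      have "h n \<in> add_span (\<Union>i. case i of (p, q) \<Rightarrow> ?S p q)" for n
      proof -
        obtain m where m: "h n \<in> dg_W A m n" using h(1) W_exhaustive by blast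
        obtain P y where P: "finite P" "\<forall>p\<in>P. y p \<in> ?S (- p) (n + p)" "h n = sum y P"
          using W_eigen_decomposition[OF \<theta> m] by metis
        show ?thesis unfolding P(3)
        proof (rule sum_in_add_span[OF P(1)])
          fix p assume "p \<in> P"
          then show "y p \<in> (\<Union>i. case i of (p, q) \<Rightarrow> ?S p q)"
            using P(2) by (intro UN_I[of "(- p, n + p)"]) auto
        qed
      qed
      then show "x \<in> add_span (\<Union>i. case i of (p, q) \<Rightarrow> ?S p q)"
        unfolding h(2) by (intro add_span_sum)
    qed
  next
    fix I :: "(int \<times> int) set" and h i
    assume I: "finite I" "\<And>i. i \<in> I \<Longrightarrow> h i \<in> (case i of (p, q) \<Rightarrow> ?S p q)"
      "sum h I = 0" "i \<in> I"
    have h: "h i \<in> dg_deg A (fst i + snd i)" "\<theta> (h i) = dg_smul A (of_int (- fst i)) (h i)"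
      if "i \<in> I" for i
      using I(2)[OF that] by (auto simp: weight_space_def split: prod.splits)
    \<comment> \<open>A relation is sorted by total degree first, where the grading separates the
      terms. Within one total degree the first index determines the second, so distinct bidegrees
      have distinct eigenvalues.\<close>
    let ?deg = "\<lambda>i. fst i + snd i"
    let ?I = "\<lambda>n. {i \<in> I. ?deg i = n}"
    have "(\<Sum>n\<in>?deg ` I. sum h (?I n)) = 0"
      using sum.image_gen[OF I(1), of h ?deg] I(3) by simp
    moreover have "sum h (?I n) \<in> dg_deg A n" for n
      using h(1) by (auto intro!: subspace_sum[OF deg_subspace])
    moreover have "0 \<in> dg_deg A n" for n using deg_subspace unfolding is_subspace_def by blast
    ultimately have "sum h (?I (?deg i)) = 0"
      using internal_dsum_independent[OF deg_dsum, of "?deg ` I" "\<lambda>n. sum h (?I n)" "?deg i"] I(1,4)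
      by simp
    moreover have "inj_on (\<lambda>i. - fst i) (?I (?deg i))" by (auto simp: inj_on_def prod_eq_iff)
    moreover have "h i \<in> ?V" if "i \<in> I" for i using h(1)[OF that] deg_car by blast
    ultimately show "h i = 0"
      using eigenvectors_independent[OF \<theta>, of "?I (?deg i)" h "\<lambda>i. - fst i" i] I(1,4) h(2)
      by simp
  qed
  have d: "dg_d A x \<in> ?S (p + int r) (q - int r + 1)" if x: "x \<in> ?S p q" for p q x
  proof -
    have car: "x \<in> ?V" by (rule S_car[OF x])
    have "dg_d A (\<theta> x) = \<theta> (dg_d A x) + dg_smul A (of_nat r) (dg_d A x)"
      using \<theta> car unfolding weight_derivation_def by blast
    then have "\<theta> (dg_d A x) = dg_smul A (of_int (- p)) (dg_d A x) - dg_smul A (of_nat r) (dg_d A x)"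
      using x car by (simp add: weight_space_def d_smul)
    also have "\<dots> = dg_smul A (of_int (- (p + int r))) (dg_d A x)"
      using smul_diff_left[of "of_int (- p)" "of_nat r" "dg_d A x"] car by simp
    finally show ?thesis using x d_deg[of x "p + q"] by (simp add: weight_space_def algebra_simps)
  qed
  have mul: "dg_mul A x y \<in> ?S (p + p') (q + q')"
    if x: "x \<in> ?S p q" and y: "y \<in> ?S p' q'" for p q p' q' x y
  proof -
    have car: "x \<in> ?V" "y \<in> ?V" using S_car x y by blast+
    then have "\<theta> (dg_mul A x y) = dg_mul A (\<theta> x) y + dg_mul A x (\<theta> y)"
      using \<theta> unfolding weight_derivation_def by blast
    also have "\<dots> = dg_smul A (of_int (- p) + of_int (- p')) (dg_mul A x y)"
      using x y car add_smul[of "of_int (- p)" "of_int (- p')" "dg_mul A x y"]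
      by (simp only: weight_space_def mem_Collect_eq mul_smul of_int_scalar mul_car car_closed)
    finally have "\<theta> (dg_mul A x y) = dg_smul A (of_int (- (p + p'))) (dg_mul A x y)" by simp
    moreover have "dg_mul A x y \<in> dg_deg A ((p + q) + (p' + q'))"
      using x y by (intro mul_deg) (auto simp: weight_space_def)
    ultimately show ?thesis by (simp add: weight_space_def algebra_simps)
  qed
  have W: "dg_W A m n = {\<Sum>p\<in>P. y p | P y. finite P \<and> P \<subseteq> {..m} \<and> (\<forall>p\<in>P. y p \<in> ?S (- p) (n + p))}" for m n
  proof (intro equalityI subsetI)
    fix x assume x: "x \<in> dg_W A m n"
    show "x \<in> {\<Sum>p\<in>P. y p | P y. finite P \<and> P \<subseteq> {..m} \<and> (\<forall>p\<in>P. y p \<in> ?S (- p) (n + p))}"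
      using W_eigen_decomposition[OF \<theta> x] by fast
  next
    fix x assume "x \<in> {\<Sum>p\<in>P. y p | P y. finite P \<and> P \<subseteq> {..m} \<and> (\<forall>p\<in>P. y p \<in> ?S (- p) (n + p))}"
    then obtain P y where P: "x = sum y P" "P \<subseteq> {..m}" "\<forall>p\<in>P. y p \<in> ?S (- p) (n + p)" by blast
    show "x \<in> dg_W A m n" unfolding P(1)
    proof (rule subspace_sum[OF W_subspace])
      fix p assume p: "p \<in> P"
      then have "y p \<in> dg_W A p n"
        using P(3) by (intro eigenvector_in_W[OF \<theta>]) (auto simp: weight_space_def)
      then show "y p \<in> dg_W A m n" using W_mono[of p m n] p P(2) by auto
    qed
  qed
  show ?thesis unfolding r_splitting_def
    by (intro conjI allI impI sub dsum d mul W)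
qed

end

text \<open>A bidegree amounts to a total degree together with an eigenvalue. A morphism always
  preserves the former, so respecting the bigrading means exactly commuting with the
  derivations.\<close>

lemma mor_has_splitting_iff:
  fixes F :: "'k::field_char_0 set"
  assumes f: "fdga_mor F A B f"
  shows "mor_has_splitting F r A B f \<longleftrightarrow> (\<exists>\<alpha> \<beta>. weight_derivation F r A \<alpha> \<and>
      weight_derivation F r B \<beta> \<and> (\<forall>x\<in>dg_car A. f (\<alpha> x) = \<beta> (f x)))"
proof -
  interpret A: filtered_dga_char0 F A
    using f by unfold_locales (simp add: fdga_mor_def)
  interpret B: filtered_dga_char0 F B
    using f by unfold_locales (simp add: fdga_mor_def)
  have f_add: "additive_on (dg_car A) f"
    using f by (simp add: fdga_mor_def additive_on_def)
  have f_car: "f x \<in> dg_car B" if "x \<in> dg_car A" for x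
    using f that by (simp add: fdga_mor_def)
  have f_smul: "f (dg_smul A c x) = dg_smul B c (f x)" if "c \<in> F" "x \<in> dg_car A" for c x
    using f that by (simp add: fdga_mor_def)
  show ?thesis
  proof
    assume "mor_has_splitting F r A B f"
    then obtain SA SB where SA: "r_splitting F r A SA" and SB: "r_splitting F r B SB"
      and fS: "\<forall>p q. f ` SA p q \<subseteq> SB p q" unfolding mor_has_splitting_def by blast
    obtain \<alpha> where \<alpha>: "weight_derivation F r A \<alpha>"
      "\<And>p q x. x \<in> SA p q \<Longrightarrow> \<alpha> x = dg_smul A (of_int (- p)) x"
      using A.splitting_imp_weight_derivation[OF SA] by blast
    obtain \<beta> where \<beta>: "weight_derivation F r B \<beta>"
      "\<And>p q x. x \<in> SB p q \<Longrightarrow> \<beta> x = dg_smul B (of_int (- p)) x"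
      using B.splitting_imp_weight_derivation[OF SB] by blast
    have dsum: "internal_dsum (\<lambda>(p, q). SA p q) (dg_car A)"
      using SA unfolding r_splitting_def by blast
    have sub: "(\<Union>i. case i of (p, q) \<Rightarrow> SA p q) \<subseteq> dg_car A"
      using dsum unfolding internal_dsum_def by blast
    have \<alpha>': "additive_on (dg_car A) \<alpha>" "\<And>x. x \<in> dg_car A \<Longrightarrow> \<alpha> x \<in> dg_car A"
      using \<alpha>(1) unfolding weight_derivation_def by blast+
    have \<beta>': "additive_on (dg_car B) \<beta>" using \<beta>(1) unfolding weight_derivation_def by blast
    have "f (\<alpha> x) = \<beta> (f x)" if "x \<in> dg_car A" for x
    proof (rule additive_on_eqI[OF additive_on_compose[OF \<alpha>'(1) f_add \<alpha>'(2)]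
          additive_on_compose[OF f_add \<beta>' f_car] internal_dsum_generates[OF dsum] sub _ that])
      fix u assume u: "u \<in> (\<Union>i. case i of (p, q) \<Rightarrow> SA p q)"
      then obtain p q where pq: "u \<in> SA p q" by auto
      have "f u \<in> SB p q" using pq fS by blast
      moreover have "u \<in> dg_car A" using u sub by blast
      ultimately show "f (\<alpha> u) = \<beta> (f u)"
        using \<alpha>(2)[OF pq] \<beta>(2) f_smul A.of_int_scalar by metis
    qed
    then show "\<exists>\<alpha> \<beta>. weight_derivation F r A \<alpha> \<and> weight_derivation F r B \<beta> \<and>
        (\<forall>x\<in>dg_car A. f (\<alpha> x) = \<beta> (f x))" using \<alpha>(1) \<beta>(1) by blast
  next
    assume "\<exists>\<alpha> \<beta>. weight_derivation F r A \<alpha> \<and> weight_derivation F r B \<beta> \<and>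
        (\<forall>x\<in>dg_car A. f (\<alpha> x) = \<beta> (f x))"
    then obtain \<alpha> \<beta> where \<alpha>: "weight_derivation F r A \<alpha>" and \<beta>: "weight_derivation F r B \<beta>"
      and comm: "\<forall>x\<in>dg_car A. f (\<alpha> x) = \<beta> (f x)" by blast
    have "f ` weight_space A \<alpha> p q \<subseteq> weight_space B \<beta> p q" for p q
    proof
      fix y assume "y \<in> f ` weight_space A \<alpha> p q"
      then obtain x where x: "x \<in> weight_space A \<alpha> p q" and y: "y = f x" by blast
      have deg: "x \<in> dg_deg A (p + q)" and eig: "\<alpha> x = dg_smul A (of_int (- p)) x"
        using x by (simp_all add: weight_space_def)
      then have car: "x \<in> dg_car A" using A.deg_car by blast
      have "f x \<in> dg_deg B (p + q)" using f deg by (auto simp: fdga_mor_def image_subset_iff)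
      moreover have "\<beta> (f x) = dg_smul B (of_int (- p)) (f x)"
        using comm car eig f_smul A.of_int_scalar by metis
      ultimately show "y \<in> weight_space B \<beta> p q" by (simp add: y weight_space_def)
    qed
    then show "mor_has_splitting F r A B f"
      unfolding mor_has_splitting_def
      using A.weight_derivation_imp_splitting[OF \<alpha>] B.weight_derivation_imp_splitting[OF \<beta>] by blast
  qed
qed

section \<open>Base change\<close>

text \<open>The big field is regarded as a k-vector space under multiplication. Zorn's lemma gives a
  subspace H maximal among those that avoid 1; it is a complement of k, and \<pi> is the projection
  onto k along H.\<close>

lemma subfield_retraction:
  fixes k :: "'k::field set"
  assumes k: "subfield k"
  obtains \<pi> where "\<And>x y. \<pi> (x + y) = \<pi> x + \<pi> y" "\<And>a x. a \<in> k \<Longrightarrow> \<pi> (a * x) = a * \<pi> x"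
    "\<And>x. \<pi> x \<in> k" "\<pi> 1 = 1"
proof -
  have k01: "0 \<in> k" "1 \<in> k" and kadd: "\<And>a b. a \<in> k \<Longrightarrow> b \<in> k \<Longrightarrow> a + b \<in> k"
    and kmul: "\<And>a b. a \<in> k \<Longrightarrow> b \<in> k \<Longrightarrow> a * b \<in> k"
    and kneg: "\<And>a. a \<in> k \<Longrightarrow> - a \<in> k" and kinv: "\<And>a. a \<in> k \<Longrightarrow> inverse a \<in> k"
    using k unfolding subfield_def by auto
  let ?\<H> = "{H. is_subspace k (*) H \<and> 1 \<notin> H}"
  have "\<exists>M\<in>?\<H>. \<forall>X\<in>?\<H>. M \<subseteq> X \<longrightarrow> X = M"
  proof (rule subset_Zorn_nonempty)
    have "{0} \<in> ?\<H>" by (simp add: is_subspace_def)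
    then show "?\<H> \<noteq> {}" by blast
  next
    fix C assume C: "C \<noteq> {}" "subset.chain ?\<H> C"
    have sub: "is_subspace k (*) H" "1 \<notin> H" if "H \<in> C" for H
      using C(2) that unfolding subset.chain_def by auto
    have total: "H \<subseteq> H' \<or> H' \<subseteq> H" if "H \<in> C" "H' \<in> C" for H H'
      using C(2) that unfolding subset.chain_def by blast
    have "x + y \<in> \<Union>C" if xy: "x \<in> \<Union>C" "y \<in> \<Union>C" for x y
    proof -
      obtain H where H: "x \<in> H" "H \<in> C" using xy by blast
      obtain H' where H': "y \<in> H'" "H' \<in> C" using xy by blast
      obtain H'' where "x \<in> H''" "y \<in> H''" "H'' \<in> C" using total H H' by blast
      then show ?thesis using sub(1) unfolding is_subspace_def by blast
    qed
    moreover have "0 \<in> \<Union>C" using C(1) sub(1) unfolding is_subspace_def by blast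
    moreover have "c * x \<in> \<Union>C" if "c \<in> k" "x \<in> \<Union>C" for c x
      using that sub(1) unfolding is_subspace_def by blast
    ultimately show "\<Union>C \<in> ?\<H>" using sub(2) unfolding is_subspace_def by blast
  qed
  then obtain H where H: "is_subspace k (*) H" "1 \<notin> H"
    and max: "\<And>X. is_subspace k (*) X \<Longrightarrow> 1 \<notin> X \<Longrightarrow> H \<subseteq> X \<Longrightarrow> X = H" by blast
  have H0: "0 \<in> H" and Hadd: "\<And>x y. x \<in> H \<Longrightarrow> y \<in> H \<Longrightarrow> x + y \<in> H"
    and Hmul: "\<And>c x. c \<in> k \<Longrightarrow> x \<in> H \<Longrightarrow> c * x \<in> H"
    using H(1) unfolding is_subspace_def by auto
  have Hneg: "- x \<in> H" if "x \<in> H" for x using Hmul[OF kneg[OF k01(2)] that] by simp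
  have ex: "\<exists>a\<in>k. x - a \<in> H" for x
  proof (cases "x \<in> H")
    case True
    then show ?thesis using k01 by (intro bexI[of _ 0]) auto
  next
    case False
    \<comment> \<open>By maximality of H the strictly larger space X, spanned by H and x, contains
      1. Solving \<open>1 = h + a * x\<close> for x exhibits \<open>inverse a\<close> as its
      component in k.\<close>
    define X where "X = {h + a * x | h a. h \<in> H \<and> a \<in> k}"
    have "is_subspace k (*) X" unfolding is_subspace_def
    proof (intro conjI ballI)
      show "0 \<in> X" unfolding X_def using H0 k01 by (intro CollectI exI[of _ 0]) auto
    next
      fix u v assume "u \<in> X" "v \<in> X"
      then obtain h a h' a' where "h \<in> H" "a \<in> k" "u = h + a * x" "h' \<in> H" "a' \<in> k" "v = h' + a' * x"
        unfolding X_def by blast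
      then show "u + v \<in> X" unfolding X_def using Hadd kadd
        by (intro CollectI exI[of _ "h + h'"] exI[of _ "a + a'"]) (auto simp: algebra_simps)
    next
      fix c u assume "c \<in> k" "u \<in> X"
      then obtain h a where "h \<in> H" "a \<in> k" "u = h + a * x" unfolding X_def by blast
      then show "c * u \<in> X" unfolding X_def using \<open>c \<in> k\<close> Hmul kmul
        by (intro CollectI exI[of _ "c * h"] exI[of _ "c * a"]) (auto simp: algebra_simps)
    qed
    moreover have "H \<subseteq> X"
    proof
      fix h assume "h \<in> H"
      then show "h \<in> X" unfolding X_def using k01 by (intro CollectI exI[of _ h] exI[of _ 0]) auto
    qed
    moreover have "x \<in> X" unfolding X_def using H0 k01 by (intro CollectI exI[of _ 0] exI[of _ 1]) auto
    ultimately have "1 \<in> X" using max[of X] False by blast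
    then obtain h a where ha: "h \<in> H" "a \<in> k" "1 = h + a * x" unfolding X_def by blast
    then have "a \<noteq> 0" using H(2) by auto
    then have "x - inverse a = inverse a * (a * x - 1)" by (simp add: algebra_simps)
    also have "a * x - 1 = - h" using ha(3) by (simp add: algebra_simps)
    finally have "x - inverse a = - (inverse a * h)" by simp
    moreover have "- (inverse a * h) \<in> H" using ha(1,2) Hmul Hneg kinv by blast
    ultimately show ?thesis using ha(2) kinv by metis
  qed
  have k_Int_H: "a = 0" if "a \<in> k" "a \<in> H" for a
  proof (rule ccontr)
    assume "a \<noteq> 0"
    then have "inverse a * a = 1" by simp
    then show False using Hmul[OF kinv[OF that(1)] that(2)] H(2) by simp
  qed
  have uniq: "a = b" if "a \<in> k" "b \<in> k" "x - a \<in> H" "x - b \<in> H" for a b x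
  proof -
    have "a - b \<in> k" using kadd[OF that(1) kneg[OF that(2)]] by simp
    moreover have "a - b \<in> H" using Hadd[OF that(4) Hneg[OF that(3)]] by simp
    ultimately show ?thesis using k_Int_H by force
  qed
  define \<pi> where "\<pi> x = (SOME a. a \<in> k \<and> x - a \<in> H)" for x
  have \<pi>: "\<pi> x \<in> k" "x - \<pi> x \<in> H" for x
    using someI_ex[of "\<lambda>a. a \<in> k \<and> x - a \<in> H"] ex[of x] unfolding \<pi>_def by blast+
  have \<pi>I: "\<pi> x = a" if "a \<in> k" "x - a \<in> H" for a x using uniq[OF \<pi>(1) that(1) \<pi>(2) that(2)] .
  show thesis
  proof
    show "\<pi> (x + y) = \<pi> x + \<pi> y" for x y
      using Hadd[OF \<pi>(2)[of x] \<pi>(2)[of y]] kadd \<pi>(1) by (intro \<pi>I) (auto simp: algebra_simps)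
    show "\<pi> (a * x) = a * \<pi> x" if "a \<in> k" for a x
      using Hmul[OF that \<pi>(2)[of x]] kmul \<pi>(1) that by (intro \<pi>I) (auto simp: algebra_simps)
    show "\<pi> x \<in> k" for x by (rule \<pi>(1))
    show "\<pi> 1 = 1" using k01 H0 by (intro \<pi>I) auto
  qed
qed

section \<open>The base change as a tensor product\<close>

locale dga_base_change =
  A: filtered_dga k A + AK: filtered_dga UNIV AK
  for k :: "'k::field set" and A AK :: "('k, 'a::ab_group_add) fdga" +
  assumes base_change: "base_change k A AK"
begin

lemma
  shows smul_eq: "dg_smul A = dg_smul AK"
    and mul_eq: "dg_mul A = dg_mul AK"
    and d_eq: "dg_d A = dg_d AK"
    and car_subset: "dg_car A \<subseteq> dg_car AK"
    and W_axiom: "\<forall>q n. dg_W A q n = dg_W AK q n \<inter> dg_car A"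
    and car_axiom: "dg_car AK = fspan UNIV (dg_smul AK) (dg_car A)"
    and W_fspan_axiom: "\<forall>q n. dg_W AK q n = fspan UNIV (dg_smul AK) (dg_W A q n)"
    and lin_indep_axiom: "\<forall>T. finite T \<and> T \<subseteq> dg_car A \<and> lin_indep k (dg_smul A) T \<longrightarrow>
      lin_indep UNIV (dg_smul A) T"
  using base_change[unfolded base_change_def] by - (elim conjE, assumption)+

lemmas same = smul_eq[symmetric] mul_eq[symmetric] d_eq[symmetric]

lemma W_Int: "dg_W A q n = dg_W AK q n \<inter> dg_car A"
  using W_axiom by blast

lemma car_fspan: "dg_car AK = fspan UNIV (dg_smul A) (dg_car A)"
  unfolding smul_eq by (rule car_axiom)

lemma W_fspan: "dg_W AK q n = fspan UNIV (dg_smul A) (dg_W A q n)"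
  unfolding smul_eq using W_fspan_axiom by blast

lemma lin_indep_UNIV:
  "finite T \<Longrightarrow> T \<subseteq> dg_car A \<Longrightarrow> lin_indep k (dg_smul A) T \<Longrightarrow> lin_indep UNIV (dg_smul A) T"
  using lin_indep_axiom by blast

lemma in_AK [simp]: "x \<in> dg_car A \<Longrightarrow> x \<in> dg_car AK"
  using car_subset by blast

lemma smul_in_AK [simp]: "x \<in> dg_car AK \<Longrightarrow> dg_smul A c x \<in> dg_car AK"
  using AK.car_closed(3)[of c x] by (simp add: same)

text \<open>These are the pure tensors of a vector of A with a scalar of the big field.\<close>

abbreviation "pure \<equiv> {dg_smul A c s | c s. s \<in> dg_car A}"

lemma pure_generates: "dg_car AK \<subseteq> add_span pure" and pure_car: "pure \<subseteq> dg_car AK"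
  using fspan_subset_add_span[of UNIV "dg_smul A" "dg_car A"] by (auto simp: car_fspan[symmetric])

text \<open>A linear relation over K between elements of A is a consequence of relations over k,
  hence is respected by every k-balanced map; this is what makes AK a tensor product.\<close>

lemma balanced_relation:
  assumes g1: "\<And>c c' s. s \<in> dg_car A \<Longrightarrow> g (c + c') s = g c s + g c' s"
    and g2: "\<And>c. additive_on (dg_car A) (g c)"
    and bal: "\<And>c a s. a \<in> k \<Longrightarrow> s \<in> dg_car A \<Longrightarrow> g (c * a) s = g c (dg_smul A a s)"
    and T: "finite T" "T \<subseteq> dg_car A" "(\<Sum>s\<in>T. dg_smul A (c s) s) = 0"
  shows "(\<Sum>s\<in>T. g (c s) s) = 0"
  using T
proof (induction T arbitrary: c rule: finite_psubset_induct)
  case (psubset T)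
  have g0: "g 0 s = 0" if "s \<in> dg_car A" for s using g1[OF that, of 0 0] by simp
  show ?case
  proof (cases "lin_indep k (dg_smul A) T")
    case True
    then have "lin_indep UNIV (dg_smul A) T" using lin_indep_UNIV psubset by blast
    then have "c s = 0" if "s \<in> T" for s using psubset.prems(2) that unfolding lin_indep_def by blast
    then show ?thesis using g0 psubset.prems(1) by (auto intro!: sum.neutral)
  next
    case False
    \<comment> \<open>The vector t is a combination of the others with coefficients \<open>b\<close>
      in k. Substituting it into the given relation eliminates t and leaves the coefficients
      \<open>c'\<close> on a smaller set.\<close>
    then obtain a t where a: "\<forall>s\<in>T. a s \<in> k" "(\<Sum>s\<in>T. dg_smul A (a s) s) = 0"
      and t: "t \<in> T" "a t \<noteq> 0" unfolding lin_indep_def by blast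
    have car: "s \<in> dg_car A" if "s \<in> T" for s using that psubset.prems(1) by blast
    define b where "b s = - (inverse (a t) * a s)" for s
    have b: "b s \<in> k" if "s \<in> T" for s using a(1) t(1) that by (simp add: b_def)
    let ?T = "T - {t}"
    have "0 = dg_smul A (- inverse (a t)) (\<Sum>s\<in>T. dg_smul A (a s) s)"
      using a(1,2) t(1) by simp
    also have "\<dots> = (\<Sum>s\<in>T. dg_smul A (- inverse (a t)) (dg_smul A (a s) s))"
      using a(1) t(1) car psubset.hyps
      by (intro conjunct2[OF additive_on_sum[OF A.additive_smul]]) auto
    also have "\<dots> = (\<Sum>s\<in>T. dg_smul A (b s) s)"
      using a(1) t(1) car by (intro sum.cong) (auto simp: A.smul_smul b_def)
    also have "\<dots> = dg_smul A (b t) t + (\<Sum>s\<in>?T. dg_smul A (b s) s)"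
      using t(1) psubset.hyps by (rule sum.remove[rotated])
    also have "dg_smul A (b t) t = - t"
      using t car A.smul_minus_one by (simp add: b_def)
    finally have t_eq: "t = (\<Sum>s\<in>?T. dg_smul A (b s) s)" by (simp add: algebra_simps)
    define c' where "c' s = c s + c t * b s" for s
    have "(\<Sum>s\<in>?T. dg_smul A (c' s) s)
        = (\<Sum>s\<in>?T. dg_smul A (c s) s + dg_smul A (c t) (dg_smul A (b s) s))"
    proof (rule sum.cong)
      fix s assume "s \<in> ?T"
      then have "s \<in> dg_car AK" using car by simp
      then show "dg_smul A (c' s) s = dg_smul A (c s) s + dg_smul A (c t) (dg_smul A (b s) s)"
        using AK.add_smul[of "c s" "c t * b s" s] AK.smul_smul[of "c t" "b s" s]
        by (simp add: c'_def same)
    qed simp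
    also have "\<dots> = (\<Sum>s\<in>?T. dg_smul A (c s) s) + dg_smul A (c t) (\<Sum>s\<in>?T. dg_smul A (b s) s)"
      using conjunct2[OF additive_on_sum[OF AK.additive_smul, of "c t" ?T "\<lambda>s. dg_smul A (b s) s"]]
        car psubset.hyps by (simp add: sum.distrib same)
    also have "\<dots> = (\<Sum>s\<in>T. dg_smul A (c s) s)"
      unfolding t_eq[symmetric] using sum.remove[OF psubset.hyps t(1), of "\<lambda>s. dg_smul A (c s) s"]
      by (simp add: add.commute)
    finally have "(\<Sum>s\<in>?T. dg_smul A (c' s) s) = 0" using psubset.prems(2) by simp
    then have "(\<Sum>s\<in>?T. g (c' s) s) = 0"
      using psubset.IH[of ?T c'] psubset.prems(1) t(1) by blast
    \<comment> \<open>Balancedness moves the factor \<open>b s\<close> from the scalar slot to the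
      vector slot; this is where it matters that \<open>b\<close> takes values in k.\<close>
    moreover have "(\<Sum>s\<in>?T. g (c' s) s) = (\<Sum>s\<in>?T. g (c s) s + g (c t) (dg_smul A (b s) s))"
      using car b by (intro sum.cong) (auto simp: c'_def g1 bal)
    moreover have "\<dots> = (\<Sum>s\<in>?T. g (c s) s) + g (c t) (\<Sum>s\<in>?T. dg_smul A (b s) s)"
      using conjunct2[OF additive_on_sum[OF g2, of ?T "\<lambda>s. dg_smul A (b s) s" "c t"]]
        car b psubset.hyps by (simp add: sum.distrib)
    moreover have "\<dots> = (\<Sum>s\<in>T. g (c s) s)"
      unfolding t_eq[symmetric] using sum.remove[OF psubset.hyps t(1), of "\<lambda>s. g (c s) s"]
      by (simp add: add.commute)
    ultimately show ?thesis by simp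
  qed
qed

text \<open>The universal property of the tensor product: the generators are one copy of the scalars
  for each vector s of A, and all relations among them are respected by the balanced map g.\<close>

lemma extend_balanced:
  assumes g1: "\<And>c c' s. s \<in> dg_car A \<Longrightarrow> g (c + c') s = g c s + g c' s"
    and g2: "\<And>c. additive_on (dg_car A) (g c)"
    and bal: "\<And>c a s. a \<in> k \<Longrightarrow> s \<in> dg_car A \<Longrightarrow> g (c * a) s = g c (dg_smul A a s)"
  obtains E where "additive_on (dg_car AK) E" "\<And>c s. s \<in> dg_car A \<Longrightarrow> E (dg_smul A c s) = g c s"
proof (rule extend_additive[where J = "dg_car A" and G = "\<lambda>_. UNIV" and X = "dg_car AK"
      and u = "\<lambda>s c. dg_smul A c s" and v = "\<lambda>s c. g c s"])
  show "dg_smul A (c + c') s = dg_smul A c s + dg_smul A c' s" if "s \<in> dg_car A" for c c' s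
    using AK.add_smul[of c c' s] that by (simp add: same)
  show "g (c + c') s = g c s + g c' s" if "s \<in> dg_car A" for c c' s by (rule g1[OF that])
  show "(\<Sum>s\<in>I. g (h s) s) = 0"
    if "finite I" "I \<subseteq> dg_car A" "(\<Sum>s\<in>I. dg_smul A (h s) s) = 0" for I h
    using balanced_relation[of g, OF g1 g2 bal that] .
  show "dg_car AK = {\<Sum>s\<in>I. dg_smul A (h s) s | I h. finite I \<and> I \<subseteq> dg_car A \<and> (\<forall>i\<in>I. h i \<in> UNIV)}"
    unfolding car_fspan fspan_def by auto
qed (use that in auto)

section \<open>Descent of derivations along a retraction\<close>

text \<open>P is the identity of A tensored with \<pi>; k-linearity of \<pi> is what makes the
  prescription balanced.\<close>

lemma base_change_projection:
  assumes "\<And>x y. \<pi> (x + y) = \<pi> x + \<pi> y" "\<And>a x. a \<in> k \<Longrightarrow> \<pi> (a * x) = a * \<pi> x" "\<And>x. \<pi> x \<in> k"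
  obtains P where "additive_on (dg_car AK) P"
    "\<And>c s. s \<in> dg_car A \<Longrightarrow> P (dg_smul A c s) = dg_smul A (\<pi> c) s"
proof (rule extend_balanced[of "\<lambda>c. dg_smul A (\<pi> c)"])
  show "dg_smul A (\<pi> (c * a)) s = dg_smul A (\<pi> c) (dg_smul A a s)"
    if "a \<in> k" "s \<in> dg_car A" for c a s
    using that assms(2)[of a c] assms(3) by (simp add: A.smul_smul mult.commute)
qed (use assms that in \<open>auto simp: A.add_smul intro!: A.additive_smul\<close>)

text \<open>W of the base change is spanned by W of A, and P replaces the coefficients of such a
  combination by elements of k without touching the vectors.\<close>

lemma W_descend:
  assumes P: "additive_on (dg_car AK) P" "\<And>c s. s \<in> dg_car A \<Longrightarrow> P (dg_smul A c s) = dg_smul A (\<pi> c) s"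
    and \<pi>: "\<And>c. \<pi> c \<in> k" and x: "x \<in> dg_W AK q n"
  shows "P x \<in> dg_W A q n"
proof -
  obtain T c where T: "finite T" "T \<subseteq> dg_W A q n" "x = (\<Sum>s\<in>T. dg_smul A (c s) s)"
    using x unfolding W_fspan fspan_def by blast
  have car: "s \<in> dg_car A" if "s \<in> T" for s using that T(2) A.W_car by blast
  have "P x = (\<Sum>s\<in>T. P (dg_smul A (c s) s))"
    unfolding T(3) using car by (intro conjunct2[OF additive_on_sum[OF P(1) T(1)]]) auto
  also have "\<dots> = (\<Sum>s\<in>T. dg_smul A (\<pi> (c s)) s)" using car P(2) by simp
  also have "\<dots> \<in> dg_W A q n"
    using T(2) \<pi> A.W_subspace[of q n]
    by (intro A.subspace_sum[OF A.W_subspace]) (auto simp: is_subspace_def)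
  finally show ?thesis .
qed

text \<open>P is linear over A and commutes with d, so it can be applied to each equation for
  \<theta> evaluated on A. It fixes A because \<open>\<pi> 1 = 1\<close>, so the terms that do not
  involve \<theta> are unchanged.\<close>

lemma weight_derivation_descend:
  assumes P: "additive_on (dg_car AK) P" "\<And>c s. s \<in> dg_car A \<Longrightarrow> P (dg_smul A c s) = dg_smul A (\<pi> c) s"
    and \<pi>: "\<And>c. \<pi> c \<in> k" "\<And>a c. a \<in> k \<Longrightarrow> \<pi> (a * c) = a * \<pi> c" "\<pi> 1 = 1"
    and \<theta>: "weight_derivation UNIV r AK \<theta>"
  shows "weight_derivation k r A (\<lambda>x. P (\<theta> x))"
proof -
  have P_A: "P x = x" if "x \<in> dg_car A" for x using P(2)[OF that, of 1] that \<pi>(3) by simp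
  have P_car: "P x \<in> dg_car A" if "x \<in> dg_car AK" for x
    by (rule additive_on_memI[OF P(1) pure_generates pure_car _ _ _ that]) (auto simp: P(2) \<pi>(1))
  have \<theta>_car: "\<theta> x \<in> dg_car AK" if "x \<in> dg_car AK" for x
    using \<theta> that unfolding weight_derivation_def by blast
  have add: "additive_on (dg_car AK) \<theta>" using \<theta> unfolding weight_derivation_def by blast
  have P_smul: "P (dg_smul A a x) = dg_smul A a (P x)" if a: "a \<in> k" and x: "x \<in> dg_car AK" for a x
  proof (rule additive_on_eqI[OF _ _ pure_generates pure_car _ x])
    show "additive_on (dg_car AK) (\<lambda>x. P (dg_smul A a x))"
      using AK.additive_smul[of a] by (intro additive_on_compose[OF _ P(1)]) (simp_all add: same)
    show "additive_on (dg_car AK) (\<lambda>x. dg_smul A a (P x))"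
      using a by (intro additive_on_compose[OF P(1) A.additive_smul] P_car)
    fix u assume "u \<in> pure"
    then obtain c s where u: "u = dg_smul A c s" "s \<in> dg_car A" by blast
    have "dg_smul A a u = dg_smul A (a * c) s"
      using u AK.smul_smul[of a c s] by (simp add: same)
    then show "P (dg_smul A a u) = dg_smul A a (P u)"
      using u a by (simp add: P(2) \<pi> A.smul_smul)
  qed
  have P_mul: "P (dg_mul A x y) = dg_mul A (P x) y" "P (dg_mul A y x) = dg_mul A y (P x)"
    if x: "x \<in> dg_car AK" and y: "y \<in> dg_car A" for x y
  proof -
    have 1: "additive_on (dg_car AK) (\<lambda>x. P (dg_mul A x y))"
      using AK.additive_mul(1)[of y] y AK.mul_car[of _ y]
      by (intro additive_on_compose[OF _ P(1)]) (simp_all add: same)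
    have 2: "additive_on (dg_car AK) (\<lambda>x. dg_mul A (P x) y)"
      using y by (intro additive_on_compose[OF P(1) A.additive_mul(1)] P_car)
    have 3: "additive_on (dg_car AK) (\<lambda>x. P (dg_mul A y x))"
      using AK.additive_mul(2)[of y] y AK.mul_car[of y]
      by (intro additive_on_compose[OF _ P(1)]) (simp_all add: same)
    have 4: "additive_on (dg_car AK) (\<lambda>x. dg_mul A y (P x))"
      using y by (intro additive_on_compose[OF P(1) A.additive_mul(2)] P_car)
    have pure: "P (dg_mul A u y) = dg_mul A (P u) y" "P (dg_mul A y u) = dg_mul A y (P u)"
      if "u \<in> pure" for u
    proof -
      obtain c s where u: "u = dg_smul A c s" "s \<in> dg_car A" using \<open>u \<in> pure\<close> by blast
      have "dg_mul A u y = dg_smul A c (dg_mul A s y)" "dg_mul A y u = dg_smul A c (dg_mul A y s)"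
        using u y AK.mul_smul[of c s y] AK.mul_smul[of c y s] by (simp_all add: same)
      then show "P (dg_mul A u y) = dg_mul A (P u) y" "P (dg_mul A y u) = dg_mul A y (P u)"
        using u y \<pi>(1) by (simp_all add: P(2) A.mul_smul)
    qed
    show "P (dg_mul A x y) = dg_mul A (P x) y"
      by (rule additive_on_eqI[OF 1 2 pure_generates pure_car pure(1) x])
    show "P (dg_mul A y x) = dg_mul A y (P x)"
      by (rule additive_on_eqI[OF 3 4 pure_generates pure_car pure(2) x])
  qed
  have P_d: "P (dg_d A x) = dg_d A (P x)" if x: "x \<in> dg_car AK" for x
  proof (rule additive_on_eqI[OF _ _ pure_generates pure_car _ x])
    show "additive_on (dg_car AK) (\<lambda>x. P (dg_d A x))"
      using AK.additive_d AK.d_car by (intro additive_on_compose[OF _ P(1)]) (simp_all add: same)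
    show "additive_on (dg_car AK) (\<lambda>x. dg_d A (P x))"
      by (intro additive_on_compose[OF P(1) A.additive_d] P_car)
    fix u assume "u \<in> pure"
    then obtain c s where u: "u = dg_smul A c s" "s \<in> dg_car A" by blast
    have "dg_d A u = dg_smul A c (dg_d A s)" using u AK.d_smul[of c s] by (simp add: same)
    then show "P (dg_d A u) = dg_d A (P u)" using u by (simp add: P(2) \<pi>(1) A.d_smul)
  qed
  show ?thesis unfolding weight_derivation_def
  proof (intro conjI ballI allI)
    show "P (\<theta> x) \<in> dg_car A" if "x \<in> dg_car A" for x using that P_car \<theta>_car by simp
    \<comment> \<open>Multiplication by 0 is a sample additive map that witnesses the closure of
      \<open>dg_car A\<close> under addition.\<close>
    show "additive_on (dg_car A) (\<lambda>x. P (\<theta> x))"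
      by (rule additive_on_subset[OF additive_on_compose[OF add P(1) \<theta>_car] car_subset
            A.additive_smul[of 0]]) simp_all
    show "P (\<theta> (dg_smul A c x)) = dg_smul A c (P (\<theta> x))" if "c \<in> k" "x \<in> dg_car A" for c x
    proof -
      have "\<theta> (dg_smul A c x) = dg_smul A c (\<theta> x)"
        using \<theta> that unfolding weight_derivation_def same by simp
      then show ?thesis using that P_smul \<theta>_car by simp
    qed
    show "P (\<theta> (dg_mul A x y)) = dg_mul A (P (\<theta> x)) y + dg_mul A x (P (\<theta> y))"
      if "x \<in> dg_car A" "y \<in> dg_car A" for x y
    proof -
      have "\<theta> (dg_mul A x y) = dg_mul A (\<theta> x) y + dg_mul A x (\<theta> y)"
        using \<theta> that unfolding weight_derivation_def same by simp
      moreover have "dg_mul A (\<theta> x) y \<in> dg_car AK" "dg_mul A x (\<theta> y) \<in> dg_car AK"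
        using that AK.mul_car \<theta>_car by (simp_all add: same)
      ultimately have "P (\<theta> (dg_mul A x y)) = P (dg_mul A (\<theta> x) y) + P (dg_mul A x (\<theta> y))"
        using P(1) unfolding additive_on_def by simp
      then show ?thesis using P_mul that \<theta>_car by simp
    qed
    show "dg_d A (P (\<theta> x)) = P (\<theta> (dg_d A x)) + dg_smul A (of_nat r) (dg_d A x)"
      if "x \<in> dg_car A" for x
    proof -
      have "P (dg_d A (\<theta> x)) = P (\<theta> (dg_d A x) + dg_smul A (of_nat r) (dg_d A x))"
        using \<theta> that unfolding weight_derivation_def same by simp
      also have "\<dots> = P (\<theta> (dg_d A x)) + P (dg_smul A (of_nat r) (dg_d A x))"
        using P(1) that \<theta>_car unfolding additive_on_def by simp
      finally show ?thesis using that P_d \<theta>_car P_A by simp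
    qed
    show "P (\<theta> x) - dg_smul A (of_int q) x \<in> dg_W A (q - 1) n" if x: "x \<in> dg_W A q n" for q n x
    proof -
      have car: "x \<in> dg_car A" using x A.W_car by blast
      have "x \<in> dg_W AK q n" using x W_Int by blast
      then have "\<theta> x - dg_smul A (of_int q) x \<in> dg_W AK (q - 1) n"
        using \<theta> unfolding weight_derivation_def same by blast
      then have "P (\<theta> x - dg_smul A (of_int q) x) \<in> dg_W A (q - 1) n"
        using W_descend P \<pi>(1) by blast
      moreover have "P (\<theta> x - dg_smul A (of_int q) x) = P (\<theta> x) - P (dg_smul A (of_int q) x)"
        using car \<theta>_car by (intro additive_on_diff[OF P(1)]) simp_all
      ultimately show ?thesis using P_A car by simp
    qed
  qed
qed

section \<open>Extension of derivations to the base change\<close>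

text \<open>E is \<theta> tensored with the identity on scalars. The algebraic identities are
  additive and reduce to pure tensors, where scalars factor out; the weight condition instead needs
  an expansion adapted to W.\<close>

lemma weight_derivation_extend:
  assumes \<theta>: "weight_derivation k r A \<theta>"
    and E: "additive_on (dg_car AK) E" "\<And>c s. s \<in> dg_car A \<Longrightarrow> E (dg_smul A c s) = dg_smul A c (\<theta> s)"
  shows "weight_derivation UNIV r AK E"
proof -
  have \<theta>_car: "\<theta> x \<in> dg_car A" if "x \<in> dg_car A" for x
    using \<theta> that unfolding weight_derivation_def by blast
  have E_car: "E x \<in> dg_car AK" if "x \<in> dg_car AK" for x
    by (rule additive_on_memI[OF E(1) pure_generates pure_car _ _ _ that]) (auto simp: E(2) \<theta>_car)
  have E_A: "E x = \<theta> x" if "x \<in> dg_car A" for x using E(2)[OF that, of 1] that \<theta>_car by simp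
  have E_smul: "E (dg_smul A c x) = dg_smul A c (E x)" if x: "x \<in> dg_car AK" for c x
  proof (rule additive_on_eqI[OF _ _ pure_generates pure_car _ x])
    note add = AK.additive_smul[of c, unfolded same, OF UNIV_I]
    show "additive_on (dg_car AK) (\<lambda>x. E (dg_smul A c x))"
      by (intro additive_on_compose[OF add E(1)]) simp
    show "additive_on (dg_car AK) (\<lambda>x. dg_smul A c (E x))"
      by (intro additive_on_compose[OF E(1) add] E_car)
    fix u assume "u \<in> pure"
    then obtain a s where u: "u = dg_smul A a s" "s \<in> dg_car A" by blast
    then show "E (dg_smul A c u) = dg_smul A c (E u)"
      using AK.smul_smul[of c a, unfolded same, OF UNIV_I UNIV_I] \<theta>_car by (simp add: E(2))
  qed
  show ?thesis unfolding weight_derivation_def same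
  proof (intro conjI ballI allI)
    fix x y assume x: "x \<in> dg_car AK" and y: "y \<in> dg_car AK"
    note mul = AK.additive_mul[unfolded same]
    have hom: "E (dg_mul A u v) = dg_mul A (E u) v + dg_mul A u (E v)"
      if "u \<in> pure" "v \<in> pure" for u v
    proof -
      obtain a s where u: "u = dg_smul A a s" "s \<in> dg_car A" using \<open>u \<in> pure\<close> by blast
      obtain b t where v: "v = dg_smul A b t" "t \<in> dg_car A" using \<open>v \<in> pure\<close> by blast
      note smul = AK.mul_smul[unfolded same, OF UNIV_I] AK.smul_add[unfolded same, OF UNIV_I]
      have "\<theta> (dg_mul A s t) = dg_mul A (\<theta> s) t + dg_mul A s (\<theta> t)"
        using \<theta> u v unfolding weight_derivation_def by blast
      then show ?thesis
        using u v \<theta>_car by (simp add: smul E(2) E_smul E_A)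
    qed
    have hom1: "E (dg_mul A u y) = dg_mul A (E u) y + dg_mul A u (E y)" if "u \<in> pure" for u
    proof (rule additive_on_eqI[OF _ _ pure_generates pure_car hom[OF that] y])
      have u: "u \<in> dg_car AK" using that pure_car by blast
      show "additive_on (dg_car AK) (\<lambda>v. E (dg_mul A u v))"
        using u by (intro additive_on_compose[OF mul(2) E(1)]) (use AK.mul_car in \<open>auto simp: same\<close>)
      show "additive_on (dg_car AK) (\<lambda>v. dg_mul A (E u) v + dg_mul A u (E v))"
        using u by (intro additive_on_plus additive_on_compose[OF E(1) mul(2)] mul(2) E_car)
    qed
    show "E (dg_mul A x y) = dg_mul A (E x) y + dg_mul A x (E y)"
    proof (rule additive_on_eqI[OF _ _ pure_generates pure_car hom1 x])
      show "additive_on (dg_car AK) (\<lambda>v. E (dg_mul A v y))"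
        using y by (intro additive_on_compose[OF mul(1) E(1)]) (use AK.mul_car in \<open>auto simp: same\<close>)
      show "additive_on (dg_car AK) (\<lambda>v. dg_mul A (E v) y + dg_mul A v (E y))"
        using y by (intro additive_on_plus additive_on_compose[OF E(1) mul(1)] mul(1) E_car)
    qed
  next
    fix x assume x: "x \<in> dg_car AK"
    note d = AK.additive_d[unfolded same] and d_car = AK.d_car[unfolded same]
    show "dg_d A (E x) = E (dg_d A x) + dg_smul A (of_nat r) (dg_d A x)"
    proof (rule additive_on_eqI[OF _ _ pure_generates pure_car _ x])
      show "additive_on (dg_car AK) (\<lambda>x. dg_d A (E x))"
        by (intro additive_on_compose[OF E(1) d] E_car)
      show "additive_on (dg_car AK) (\<lambda>x. E (dg_d A x) + dg_smul A (of_nat r) (dg_d A x))"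
        by (intro additive_on_plus additive_on_compose[OF d E(1)] d_car
            additive_on_compose[OF d AK.additive_smul[unfolded same]] UNIV_I)
      fix u assume "u \<in> pure"
      then obtain c s where u: "u = dg_smul A c s" "s \<in> dg_car A" by blast
      have du: "dg_d A (dg_smul A c s) = dg_smul A c (dg_d A s)" using u AK.d_smul[of c s] by (simp add: same)
      have "dg_d A (E u) = dg_smul A c (dg_d A (\<theta> s))"
        using u AK.d_smul[of c "\<theta> s"] \<theta>_car by (simp add: same E(2))
      also have "dg_d A (\<theta> s) = \<theta> (dg_d A s) + dg_smul A (of_nat r) (dg_d A s)"
        using \<theta> u unfolding weight_derivation_def by blast
      finally show "dg_d A (E u) = E (dg_d A u) + dg_smul A (of_nat r) (dg_d A u)"
        using AK.smul_add[of c "\<theta> (dg_d A s)" "dg_smul A (of_nat r) (dg_d A s)"]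
          AK.smul_smul[of c "of_nat r" "dg_d A s"] AK.smul_smul[of "of_nat r" c "dg_d A s"] u \<theta>_car
        by (simp add: same du E(2) mult.commute)
    qed
  next
    fix q n x assume x: "x \<in> dg_W AK q n"
    let ?D = "\<lambda>x. E x - dg_smul A (of_int q) x"
    have D: "additive_on (dg_car AK) ?D"
      by (intro additive_on_minus E(1) AK.additive_smul[unfolded same] UNIV_I)
    \<comment> \<open>The vectors in the expansion of x are taken from \<open>dg_W A q n\<close>,
      since only there is \<theta> known to act as q modulo lower weight; an arbitrary expansion
      over A would lose this information.\<close>
    obtain T c where T: "finite T" "T \<subseteq> dg_W A q n" "x = (\<Sum>s\<in>T. dg_smul A (c s) s)"
      using x unfolding W_fspan fspan_def by blast
    have car: "s \<in> dg_car A" if "s \<in> T" for s using that T(2) A.W_car by blast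
    have "?D x = (\<Sum>s\<in>T. ?D (dg_smul A (c s) s))"
      unfolding T(3) using car by (intro conjunct2[OF additive_on_sum[OF D T(1)]]) auto
    also have "\<dots> \<in> dg_W AK (q - 1) n"
    proof (rule AK.subspace_sum[OF AK.W_subspace])
      fix s assume s: "s \<in> T"
      have "\<theta> s - dg_smul A (of_int q) s \<in> dg_W A (q - 1) n"
        using \<theta> s T(2) unfolding weight_derivation_def by blast
      then have W: "dg_smul A (c s) (\<theta> s - dg_smul A (of_int q) s) \<in> dg_W AK (q - 1) n"
        using W_Int[of "q - 1" n] AK.W_subspace[of "q - 1" n] unfolding is_subspace_def same by blast
      have "dg_smul A (c s) (\<theta> s - dg_smul A (of_int q) s)
          = dg_smul A (c s) (\<theta> s) - dg_smul A (c s) (dg_smul A (of_int q) s)"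
        using s car \<theta>_car by (intro additive_on_diff[OF AK.additive_smul[unfolded same]]) auto
      also have "\<dots> = ?D (dg_smul A (c s) s)"
        using AK.smul_smul[of "c s" "of_int q" s] AK.smul_smul[of "of_int q" "c s" s] car[OF s]
        by (simp add: E(2) same mult.commute)
      finally show "?D (dg_smul A (c s) s) \<in> dg_W AK (q - 1) n" using W by simp
    qed
    finally show "?D x \<in> dg_W AK (q - 1) n" .
  qed (use E(1) E_car E_smul in auto)
qed

text \<open>The prescription on pure tensors is balanced because \<theta> is k-linear.\<close>

lemma extend_weight_derivation:
  assumes \<theta>: "weight_derivation k r A \<theta>"
  obtains E where "weight_derivation UNIV r AK E" "\<And>c s. s \<in> dg_car A \<Longrightarrow> E (dg_smul A c s) = dg_smul A c (\<theta> s)"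
proof (rule extend_balanced[of "\<lambda>c s. dg_smul A c (\<theta> s)"])
  have \<theta>_car: "\<theta> x \<in> dg_car A" if "x \<in> dg_car A" for x
    using \<theta> that unfolding weight_derivation_def by blast
  have add: "additive_on (dg_car A) \<theta>" using \<theta> unfolding weight_derivation_def by blast
  show "dg_smul A (c + c') (\<theta> s) = dg_smul A c (\<theta> s) + dg_smul A c' (\<theta> s)" if "s \<in> dg_car A" for c c' s
    using AK.add_smul[of c c' "\<theta> s"] that \<theta>_car by (simp add: same)
  show "additive_on (dg_car A) (\<lambda>s. dg_smul A c (\<theta> s))" for c
    using add \<theta>_car AK.smul_add[of c] by (simp add: additive_on_def same)
  show "dg_smul A (c * a) (\<theta> s) = dg_smul A c (\<theta> (dg_smul A a s))" if "a \<in> k" "s \<in> dg_car A" for c a s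
    using \<theta> that AK.smul_smul[of c a "\<theta> s"] \<theta>_car by (simp add: weight_derivation_def same)
  fix E assume E: "additive_on (dg_car AK) E"
    "\<And>c s. s \<in> dg_car A \<Longrightarrow> E (dg_smul A c s) = dg_smul A c (\<theta> s)"
  show thesis using that weight_derivation_extend[OF \<theta> E] E(2) by blast
qed

end

theorem theorem2p20:
  fixes k :: "'K::field_char_0 set" and r :: nat
    and A :: "('K, 'a::ab_group_add) fdga" and B :: "('K, 'b::ab_group_add) fdga"
    and AK :: "('K, 'a) fdga" and BK :: "('K, 'b) fdga"
    and f :: "'a \<Rightarrow> 'b" and fK :: "'a \<Rightarrow> 'b"
  assumes "subfield k"
    and "fg_Er_cofibrant k r A" and "fg_Er_cofibrant k r B"
    and "fdga_mor k A B f"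
    and "fdga UNIV AK" and "fdga UNIV BK"
    and "base_change k A AK" and "base_change k B BK"
    and "fdga_mor UNIV AK BK fK" and "\<forall>x\<in>dg_car A. fK x = f x"
  shows "mor_has_splitting k r A B f \<longleftrightarrow> mor_has_splitting UNIV r AK BK fK"
proof -
  have "fdga k A" "fdga k B" using assms(4) by (simp_all add: fdga_mor_def)
  interpret A: dga_base_change k A AK
    by unfold_locales fact+
  interpret B: dga_base_change k B BK
    by unfold_locales fact+
  have f_car: "f x \<in> dg_car B" if "x \<in> dg_car A" for x
    using assms(4) that by (simp add: fdga_mor_def)
  have fK_add: "additive_on (dg_car AK) fK"
    using assms(9) by (simp add: fdga_mor_def additive_on_def)
  have fK_car: "fK x \<in> dg_car BK" if "x \<in> dg_car AK" for x
    using assms(9) that by (simp add: fdga_mor_def)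
  \<comment> \<open>Linearity over the big field and agreement with f on A make \<open>fK\<close>
    the map f tensored with the identity, so it is known on all pure tensors.\<close>
  have fK_smul: "fK (dg_smul A c s) = dg_smul B c (f s)" if "s \<in> dg_car A" for c s
  proof -
    have "fK (dg_smul AK c s) = dg_smul BK c (fK s)"
      using assms(9) that A.in_AK by (simp add: fdga_mor_def)
    then show ?thesis using assms(10) that by (simp add: A.same B.same)
  qed
  show ?thesis
    unfolding mor_has_splitting_iff[OF assms(4)] mor_has_splitting_iff[OF assms(9)]
  proof
    assume "\<exists>\<alpha> \<beta>. weight_derivation k r A \<alpha> \<and> weight_derivation k r B \<beta> \<and>
        (\<forall>x\<in>dg_car A. f (\<alpha> x) = \<beta> (f x))"
    then obtain \<alpha> \<beta> where \<alpha>: "weight_derivation k r A \<alpha>" and \<beta>: "weight_derivation k r B \<beta>"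
      and comm: "\<forall>x\<in>dg_car A. f (\<alpha> x) = \<beta> (f x)" by blast
    obtain E where E: "weight_derivation UNIV r AK E"
      "\<And>c s. s \<in> dg_car A \<Longrightarrow> E (dg_smul A c s) = dg_smul A c (\<alpha> s)"
      using A.extend_weight_derivation[OF \<alpha>] by blast
    obtain E' where E': "weight_derivation UNIV r BK E'"
      "\<And>c s. s \<in> dg_car B \<Longrightarrow> E' (dg_smul B c s) = dg_smul B c (\<beta> s)"
      using B.extend_weight_derivation[OF \<beta>] by blast
    have add: "additive_on (dg_car AK) E" "\<And>x. x \<in> dg_car AK \<Longrightarrow> E x \<in> dg_car AK"
      "additive_on (dg_car BK) E'"
      using E(1) E'(1) unfolding weight_derivation_def by blast+
    have \<alpha>_car: "\<alpha> x \<in> dg_car A" if "x \<in> dg_car A" for x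
      using \<alpha> that unfolding weight_derivation_def by blast
    have "fK (E x) = E' (fK x)" if "x \<in> dg_car AK" for x
    proof (rule additive_on_eqI[OF additive_on_compose[OF add(1) fK_add add(2)]
          additive_on_compose[OF fK_add add(3) fK_car] A.pure_generates A.pure_car _ that])
      fix u assume "u \<in> A.pure"
      then obtain c s where "u = dg_smul A c s" "s \<in> dg_car A" by blast
      then show "fK (E u) = E' (fK u)"
        using comm \<alpha>_car f_car by (simp add: E(2) E'(2) fK_smul)
    qed
    then show "\<exists>\<alpha> \<beta>. weight_derivation UNIV r AK \<alpha> \<and> weight_derivation UNIV r BK \<beta> \<and>
        (\<forall>x\<in>dg_car AK. fK (\<alpha> x) = \<beta> (fK x))" using E(1) E'(1) by blast
  next
    assume "\<exists>\<alpha> \<beta>. weight_derivation UNIV r AK \<alpha> \<and> weight_derivation UNIV r BK \<beta> \<and>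
        (\<forall>x\<in>dg_car AK. fK (\<alpha> x) = \<beta> (fK x))"
    then obtain \<alpha> \<beta> where \<alpha>: "weight_derivation UNIV r AK \<alpha>"
      and \<beta>: "weight_derivation UNIV r BK \<beta>"
      and comm: "\<forall>x\<in>dg_car AK. fK (\<alpha> x) = \<beta> (fK x)" by blast
    \<comment> \<open>One and the same \<pi> has to be used for A and for B: then \<open>fK\<close>
      intertwines the two projections, because both composites send c times s to
      \<open>\<pi> c\<close> times \<open>f s\<close>.\<close>
    obtain \<pi> where \<pi>: "\<And>x y. \<pi> (x + y) = \<pi> x + \<pi> y" "\<And>a x. a \<in> k \<Longrightarrow> \<pi> (a * x) = a * \<pi> x"
      "\<And>x. \<pi> x \<in> k" "\<pi> 1 = 1" using subfield_retraction[OF assms(1)] by blast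
    obtain P where P: "additive_on (dg_car AK) P"
      "\<And>c s. s \<in> dg_car A \<Longrightarrow> P (dg_smul A c s) = dg_smul A (\<pi> c) s"
      using A.base_change_projection[OF \<pi>(1-3)] by blast
    obtain P' where P': "additive_on (dg_car BK) P'"
      "\<And>c s. s \<in> dg_car B \<Longrightarrow> P' (dg_smul B c s) = dg_smul B (\<pi> c) s"
      using B.base_change_projection[OF \<pi>(1-3)] by blast
    have P_car: "P x \<in> dg_car A" if "x \<in> dg_car AK" for x
      by (rule additive_on_memI[OF P(1) A.pure_generates A.pure_car _ _ _ that])
        (auto simp: P(2) \<pi>(3))
    have fP: "fK (P x) = P' (fK x)" if "x \<in> dg_car AK" for x
    proof (rule additive_on_eqI[OF additive_on_compose[OF P(1) fK_add]
          additive_on_compose[OF fK_add P'(1) fK_car] A.pure_generates A.pure_car _ that])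
      show "P x \<in> dg_car AK" if "x \<in> dg_car AK" for x using P_car[OF that] by simp
      fix u assume "u \<in> A.pure"
      then obtain c s where "u = dg_smul A c s" "s \<in> dg_car A" by blast
      then show "fK (P u) = P' (fK u)" using f_car by (simp add: P(2) P'(2) fK_smul)
    qed
    have \<alpha>_car: "\<alpha> x \<in> dg_car AK" if "x \<in> dg_car AK" for x
      using \<alpha> that unfolding weight_derivation_def by blast
    have "f (P (\<alpha> x)) = P' (\<beta> (f x))" if x: "x \<in> dg_car A" for x
    proof -
      have "f (P (\<alpha> x)) = fK (P (\<alpha> x))" using assms(10) P_car \<alpha>_car x by simp
      also have "\<dots> = P' (\<beta> (fK x))" using fP \<alpha>_car comm x by simp
      finally show ?thesis using assms(10) x by simp
    qed
    then show "\<exists>\<alpha> \<beta>. weight_derivation k r A \<alpha> \<and> weight_derivation k r B \<beta> \<and>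
        (\<forall>x\<in>dg_car A. f (\<alpha> x) = \<beta> (f x))"
      using A.weight_derivation_descend[OF P \<pi>(3,2,4) \<alpha>] B.weight_derivation_descend[OF P' \<pi>(3,2,4) \<beta>]
      by blast
  qed
qed

end
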